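(* Let $\Omega\subset\mathbb{R}^N$ be an open bounded Lipschitz set with $|\Omega|=m\in(0,\infty)$, let $p\in(1,\infty)$, and let $B^{(m)}\subset\mathbb{R}^N$ be any ball with volume $m$. Then $$\lambda^1_{L,p}(B^{(m)})\le\lambda^1_{L,p}(\Omega).$$
   Context: $\Gamma$ is the Gamma function, $\psi=\Gamma'/\Gamma$, $\gamma=-\Gamma'(1)$, $C_{N,p}=\frac{p\,\Gamma(N/2)}{2\pi^{N/2}}$, $\rho_N(p)=2\ln2-\gamma+\frac p2\psi(\frac N2)$. For an open bounded nonempty set $U\subset\mathbb{R}^N$, $$X^p_0(U)=\Big\{u\in L^p(\mathbb{R}^N): u=0\text{ a.e. on }\mathbb{R}^N\setminus U,\ \int_{\mathbb{R}^N}\int_{B_1(x)}\frac{|u(x)-u(y)|^p}{|x-y|^N}\,dy\,dx<\infty\Big\},$$ $$\lambda^1_{L,p}(U)=\inf\{\mathcal{E}_{L,p}(u,u):u\in X^p_0(U),\ \|u\|_{L^p(U)}=1\},$$ $$\begin{aligned}\mathcal{E}_{L,p}(u,u)&=\frac{C_{N,p}}{2}\iint_{|x-y|<1}\frac{|u(x)-u(y)|^p}{|x-y|^N}\,dx\,dy+\rho_N(p)\int_{\mathbb{R}^N}|u|^p\,dx\\&\quad+\frac{C_{N,p}}{2}\iint_{|x-y|\ge1}\frac{|u(x)-u(y)|^p-|u(x)|^p-|u(y)|^p}{|x-y|^N}\,dx\,dy.\end{aligned}$$ *)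

theory Defs
  imports "HOL-Analysis.Analysis"
begin

text \<open>
  The space \<open>\<real>\<^sup>N\<close> is an arbitrary Euclidean space \<open>'a\<close> with \<open>N = DIM('a)\<close>.

  The constants use the library's \<^const>\<open>euler_mascheroni\<close> and \<^const>\<open>Digamma\<close>; the next two
  lemmas identify them with \<open>- \<Gamma>'(1)\<close> and \<open>\<Gamma>' / \<Gamma>\<close>.
\<close>

lemma euler_mascheroni_eq_deriv_Gamma:
  "euler_mascheroni = - deriv Gamma (1 :: real)"
proof -
  have "(1 :: real) \<notin> \<int>\<^sub>\<le>\<^sub>0"
    by (auto dest: nonpos_Ints_nonpos)
  from has_field_derivative_Gamma[OF this, of UNIV]
  have "deriv Gamma (1 :: real) = Gamma 1 * Digamma 1"
    by (rule DERIV_imp_deriv)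
  thus ?thesis by simp
qed

lemma Digamma_eq_deriv_Gamma:
  fixes x :: real
  assumes "x > 0"
  shows "Digamma x = deriv Gamma x / Gamma x"
proof -
  have x: "x \<notin> \<int>\<^sub>\<le>\<^sub>0"
    using assms by (auto dest: nonpos_Ints_nonpos)
  from has_field_derivative_Gamma[OF x, of UNIV]
  have "deriv Gamma x = Gamma x * Digamma x"
    by (rule DERIV_imp_deriv)
  moreover have "Gamma x \<noteq> 0"
    using Gamma_real_pos[OF assms] by simp
  ultimately show ?thesis by simp
qed

definition C_const :: "nat \<Rightarrow> real \<Rightarrow> real" where
  "C_const N p = p * Gamma (real N / 2) / (2 * pi powr (real N / 2))"

definition rho_const :: "nat \<Rightarrow> real \<Rightarrow> real" where
  "rho_const N p = 2 * ln 2 - euler_mascheroni + p / 2 * Digamma (real N / 2)"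

text \<open>
  Elements of \<open>L\<^sup>p(\<real>\<^sup>N)\<close> are represented by Borel functions: every Lebesgue measurable function
  agrees almost everywhere with one, and everything below depends only on the a.e. class.
  On the diagonal the kernel has the value \<open>0 / 0 = 0\<close>, which is irrelevant as the
  diagonal is a null set.
\<close>

definition X0 :: "real \<Rightarrow> 'a::euclidean_space set \<Rightarrow> ('a \<Rightarrow> real) set" where
  "X0 p U = {u. u \<in> borel_measurable lborel \<and>
                integrable lborel (\<lambda>x. \<bar>u x\<bar> powr p) \<and>
                (AE x in lborel. x \<notin> U \<longrightarrow> u x = 0) \<and>
                (\<integral>\<^sup>+ x. (\<integral>\<^sup>+ y \<in> ball x 1.
                   ennreal (\<bar>u x - u y\<bar> powr p / norm (x - y) ^ DIM('a)) \<partial>lborel) \<partial>lborel) < \<infinity>}"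

definition Lp_norm :: "real \<Rightarrow> 'a::euclidean_space set \<Rightarrow> ('a \<Rightarrow> real) \<Rightarrow> real" where
  "Lp_norm p U u = (LINT x:U|lborel. \<bar>u x\<bar> powr p) powr (1 / p)"

text \<open>
  The diagonal value \<open>\<E>\<^bsub>L,p\<^esub>(u,u)\<close>. For \<open>u \<in> X0 p U\<close> with \<open>U\<close> bounded all three integrals
  converge absolutely; the integrand of the last one vanishes a.e. off \<open>U \<times> U\<close>.
\<close>

definition energy :: "real \<Rightarrow> ('a::euclidean_space \<Rightarrow> real) \<Rightarrow> real" where
  "energy p u =
     C_const DIM('a) p / 2 *
       (LINT z:{(x, y). norm (x - y) < 1}|lborel \<Otimes>\<^sub>M lborel.
          (case z of (x, y) \<Rightarrow> \<bar>u x - u y\<bar> powr p / norm (x - y) ^ DIM('a)))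
   + rho_const DIM('a) p * (LINT x|lborel. \<bar>u x\<bar> powr p)
   + C_const DIM('a) p / 2 *
       (LINT z:{(x, y). norm (x - y) \<ge> 1}|lborel \<Otimes>\<^sub>M lborel.
          (case z of (x, y) \<Rightarrow> (\<bar>u x - u y\<bar> powr p - \<bar>u x\<bar> powr p - \<bar>u y\<bar> powr p)
                               / norm (x - y) ^ DIM('a)))"

text \<open>The infimum is taken in the extended reals, so that no conventions about \<^const>\<open>Inf\<close> on
  empty or unbounded sets of reals enter.\<close>

definition lambda1 :: "real \<Rightarrow> 'a::euclidean_space set \<Rightarrow> ereal" where
  "lambda1 p U = (INF u \<in> {u \<in> X0 p U. Lp_norm p U u = 1}. ereal (energy p u))"

text \<open>
  Near each boundary point the set is the strict epigraph, in some unit direction \<open>e\<close>, of a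
  Lipschitz function on the hyperplane orthogonal to \<open>e\<close> (so that locally the boundary is its
  graph). The vector \<open>x - (x \<bullet> e) *\<^sub>R e\<close> is the orthogonal projection of \<open>x\<close> to that hyperplane.
  For \<open>N = 1\<close> the hyperplane is \<open>{0}\<close>.
\<close>

definition lipschitz_boundary :: "'a::euclidean_space set \<Rightarrow> bool" where
  "lipschitz_boundary S \<longleftrightarrow>
     (\<forall>z \<in> frontier S. \<exists>r > 0. \<exists>e. norm e = 1 \<and>
        (\<exists>L. \<exists>g :: 'a \<Rightarrow> real. L-lipschitz_on {w. w \<bullet> e = 0} g \<and>
           S \<inter> ball z r = {x \<in> ball z r. x \<bullet> e > g (x - (x \<bullet> e) *\<^sub>R e)}))"

end

theory Submission
  imports Defs
begin

text \<open>
  Let \<open>u\<close> be admissible for \<open>\<Omega>\<close>. Its symmetric decreasing rearrangement \<open>u*\<close> about the centre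
  of the ball has the same \<open>L\<^sup>p\<close> norm and vanishes off the ball, since the ball has the volume of
  \<open>\<Omega>\<close>. So it is enough that rearranging \<open>\<bar>u\<bar>\<close> does not raise the energy.

  The energy has a near term and a far term, and the far integrand is not of one sign. Both are
  controlled by one interaction integral. If \<open>u\<close> vanishes off a ball of diameter \<open>D\<close>, then the
  far integrand is zero for \<open>\<bar>x - y\<bar> \<ge> D\<close>, and for \<open>1 \<le> \<bar>x - y\<bar> < D\<close> the subtracted terms
  \<open>\<bar>u x\<bar>\<^sup>p\<close> and \<open>\<bar>u y\<bar>\<^sup>p\<close> integrate to a constant times \<open>\<parallel>u\<parallel>\<^sup>p\<close>. Hence, up to a multiple of the norm
  that depends only on \<open>D\<close>, \<open>N\<close> and \<open>p\<close>, the energy is the double integral of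
  \<open>\<bar>u x - u y\<bar>\<^sup>p K \<bar>x - y\<bar>\<close> with the nonincreasing kernel \<open>K t = t\<^sup>-\<^sup>N\<close> for \<open>t < D\<close>, and \<open>0\<close>
  beyond (lemma \<open>energy_localized\<close>). What remains is the Polya-Szego inequality for such
  interactions, lemma \<open>interaction_symmetrize_le\<close>.

  That inequality is proved by polarization. For a hyperplane and a closed half-space \<open>H\<close> that
  contains the centre, polarization puts the larger of the two values at mirror points into \<open>H\<close>.
  Convexity of \<open>\<bar>t\<bar>\<^sup>p\<close>, together with the fact that points on the same side are closer than mirror
  images across the hyperplane, shows that the interaction does not increase
  (\<open>interaction_polarize_le\<close>).

  Finitely many polarizations bring a function as close to its rearrangement as desired, with no
  compactness argument. For \<open>0 \<le> g < 1\<close> measure the distance by the excess, the integral of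
  \<open>(g - g*)\<^sup>+\<close>. Polarizing lowers it at least by a gain, which counts, for every level, the points
  that belong to the level set of \<open>g*\<close> but not of \<open>g\<close> and whose mirror images are in the opposite
  situation (\<open>excess_polarize\<close>). Averaged over reflections the gain has a positive lower bound
  in terms of the excess alone: for a fixed point \<open>x\<close> the mirror image of \<open>x\<close> is a Lipschitz
  function of the reflection, and a Lipschitz map can cover a set of positive measure only from a
  set of positive measure (\<open>emeasure_lipschitz_image_le\<close>, \<open>averaged_gain\<close>). So an excess that stays
  above \<open>\<eta> > 0\<close> could be lowered again and again by a fixed amount (\<open>ex_polarize_decrease\<close>), which
  is impossible. A subsequence converges almost everywhere, and Fatou's lemma transfers the
  inequality to the limit. An unbounded \<open>f\<close> is treated through \<open>f / (1 + f)\<close>, because increasing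
  maps commute with polarization.
\<close>

section \<open>Volume under Lipschitz maps\<close>

text \<open>
  Vitali's theorem exhausts \<open>W\<close>, up to a null set, by disjoint balls centred in \<open>W\<close>. The image of
  the part of \<open>W\<close> in a ball of radius \<open>s\<close> lies in a ball of radius \<open>L s\<close>, whose volume is \<open>L\<^sup>N\<close> times
  as large, and a Lipschitz map sends null sets to null sets. Centring the balls in \<open>W\<close> is what
  gives the sharp factor \<open>L\<^sup>N\<close>, so that \<open>L = 1\<close> yields the invariance of volume under isometries.
\<close>
lemma emeasure_lipschitz_image_le:
  fixes T :: "'a::euclidean_space \<Rightarrow> 'a"
  assumes W: "W \<in> sets borel" and Q: "Q \<in> sets borel" and QW: "Q \<subseteq> T ` W" and L: "L > 0"
    and lip: "\<And>v w. v \<in> W \<Longrightarrow> w \<in> W \<Longrightarrow> dist (T v) (T w) \<le> L * dist v w"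
  shows "emeasure lborel Q \<le> ennreal (L ^ DIM('a)) * emeasure lborel W"
proof (rule ennreal_le_epsilon)
  fix e :: real assume e: "0 < e"
  \<comment> \<open>An excess volume of \<open>e'\<close> around \<open>W\<close> becomes \<open>e\<close> after the factor \<open>L\<^sup>N\<close>.\<close>
  define e' where "e' = e / L ^ DIM('a)"
  have e': "e' > 0" using e L by (simp add: e'_def)
  obtain U where U: "open U" "W \<subseteq> U" "emeasure lborel (U - W) < ennreal e'"
    using outer_regular_lborel[OF W e'] by blast
  define K where "K = {(a, r). a \<in> W \<and> 0 < r \<and> ball a r \<subseteq> U}"
  have V: "\<exists>i. i \<in> K \<and> x \<in> ball (fst i) (snd i) \<and> snd i < d" if xW: "x \<in> W" and d: "0 < d" for x and d :: real
  proof -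
    obtain s where s: "s > 0" "ball x s \<subseteq> U" using U(1,2) xW by (meson openE subsetD)
    define r where "r = min s (d/2)"
    have "(x, r) \<in> K" using s xW d by (auto simp: K_def r_def)
    moreover have "r < d" "0 < r" using s xW d by (auto simp: r_def)
    ultimately show ?thesis by (intro exI[of _ "(x, r)"]) auto
  qed
  obtain C where C: "countable C" "C \<subseteq> K"
     "pairwise (\<lambda>i j. disjnt (ball (fst i) (snd i)) (ball (fst j) (snd j))) C"
     "negligible (W - (\<Union>i \<in> C. ball (fst i) (snd i)))"
    by (rule Vitali_covering_theorem_balls[of W K fst snd, OF V])
  define N where "N = T ` (W - (\<Union>i \<in> C. ball (fst i) (snd i)))"
  have "negligible N"
    unfolding N_def
  proof (rule negligible_locally_Lipschitz_image[OF order_refl C(4)], intro exI conjI ballI)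
    fix x y assume "x \<in> W - (\<Union>i \<in> C. ball (fst i) (snd i))" "y \<in> (W - (\<Union>i \<in> C. ball (fst i) (snd i))) \<inter> UNIV"
    then show "norm (T y - T x) \<le> L * norm (y - x)" using lip[of y x] by (auto simp: dist_norm)
  qed auto
  then have N0: "emeasure lebesgue N = 0" "N \<in> sets lebesgue"
    by (auto simp: negligible_iff_null_sets)
  \<comment> \<open>Index the countable family by natural numbers, with empty sets at the unused indices.\<close>
  define I where "I = to_nat_on C ` C"
  define B where "B n = (if n \<in> I then ball (fst (from_nat_into C n)) (snd (from_nat_into C n)) else {})" for n
  define B' where "B' n = (if n \<in> I then cball (T (fst (from_nat_into C n))) (L * snd (from_nat_into C n)) else {})" for n
  have fC: "from_nat_into C n \<in> C" if "n \<in> I" for n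
    using that by (auto simp: I_def C(1))
  have inK: "fst (from_nat_into C n) \<in> W" "0 < snd (from_nat_into C n)"
    "ball (fst (from_nat_into C n)) (snd (from_nat_into C n)) \<subseteq> U" if "n \<in> I" for n
  proof -
    have "from_nat_into C n \<in> K" using fC[OF that] C(2) by blast
    then show "fst (from_nat_into C n) \<in> W" "0 < snd (from_nat_into C n)"
      "ball (fst (from_nat_into C n)) (snd (from_nat_into C n)) \<subseteq> U"
      unfolding K_def by (simp_all add: split_beta)
  qed
  have UB: "(\<Union>i \<in> C. ball (fst i) (snd i)) = (\<Union>n. B n)"
  proof (intro equalityI subsetI)
    fix x assume "x \<in> (\<Union>i \<in> C. ball (fst i) (snd i))"
    then obtain i where "i \<in> C" "x \<in> ball (fst i) (snd i)" by auto
    then have "x \<in> B (to_nat_on C i)" by (auto simp: B_def I_def C(1))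
    then show "x \<in> (\<Union>n. B n)" by blast
  next
    fix x assume "x \<in> (\<Union>n. B n)"
    then show "x \<in> (\<Union>i \<in> C. ball (fst i) (snd i))" using fC by (fastforce simp: B_def split: if_splits)
  qed
  have disj: "disjoint_family B"
    unfolding disjoint_family_on_def
  proof safe
    fix m n x assume *: "m \<noteq> n" "x \<in> B m" "x \<in> B n"
    then have mn: "m \<in> I" "n \<in> I" by (auto simp: B_def split: if_splits)
    have "from_nat_into C m \<noteq> from_nat_into C n"
      using mn * unfolding I_def by (metis C(1) imageE from_nat_into_to_nat_on)
    then have "disjnt (B m) (B n)"
      using C(3) fC mn by (auto simp: pairwise_def B_def)
    then show "x \<in> {}" using * by (auto simp: disjnt_def)
  qed
  have vol: "emeasure lborel (B' n) = ennreal (L ^ DIM('a)) * emeasure lborel (B n)" for n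
  proof (cases "n \<in> I")
    case True
    then show ?thesis
      using inK[OF True] L
      by (simp add: B_def B'_def emeasure_cball emeasure_ball power_mult_distrib ennreal_mult' [symmetric] mult_ac less_imp_le)
  qed (auto simp: B_def B'_def)
  have Qsub: "Q \<subseteq> N \<union> (\<Union>n. B' n)"
  proof
    fix q assume "q \<in> Q"
    then obtain w where w: "w \<in> W" "q = T w" using QW by auto
    show "q \<in> N \<union> (\<Union>n. B' n)"
    proof (cases "\<exists>n. w \<in> B n")
      case False
      then have "w \<in> W - (\<Union>i \<in> C. ball (fst i) (snd i))" using w UB by auto
      then show ?thesis using w by (auto simp: N_def)
    next
      case True
      then obtain n where n: "n \<in> I" "w \<in> ball (fst (from_nat_into C n)) (snd (from_nat_into C n))"
        by (auto simp: B_def split: if_splits)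
      have "dist (T (fst (from_nat_into C n))) (T w) \<le> L * dist (fst (from_nat_into C n)) w"
        using lip inK n(1) w(1) by blast
      also have "\<dots> \<le> L * snd (from_nat_into C n)"
        using n(2) L by auto
      finally have "q \<in> B' n" using n w by (auto simp: B'_def)
      then show ?thesis by blast
    qed
  qed
  have [measurable]: "B n \<in> sets borel" "B' n \<in> sets borel" for n
    by (simp_all add: B_def B'_def)
  have "emeasure lborel U \<le> emeasure lborel W + emeasure lborel (U - W)"
    using U(1,2) W emeasure_subadditive[of W lborel "U - W"] by (simp add: Un_absorb1)
  also have "\<dots> \<le> emeasure lborel W + ennreal e'"
    using U(3) by (intro add_left_mono) simp
  finally have UW: "emeasure lborel U \<le> emeasure lborel W + ennreal e'" .
  have "(\<Sum>n. emeasure lborel (B n)) = emeasure lborel (\<Union>n. B n)"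
    using disj by (intro suminf_emeasure) auto
  also have "\<dots> \<le> emeasure lborel U"
    using U(1) inK(3) by (intro emeasure_mono) (auto simp: B_def split: if_splits)
  also note UW
  finally have sumB: "(\<Sum>n. emeasure lborel (B n)) \<le> emeasure lborel W + ennreal e'" .
  have "emeasure lborel Q = emeasure lebesgue Q" using Q by simp
  also have "\<dots> \<le> emeasure lebesgue (N \<union> (\<Union>n. B' n))"
    using Qsub N0(2) by (intro emeasure_mono) auto
  also have "\<dots> \<le> emeasure lebesgue N + emeasure lebesgue (\<Union>n. B' n)"
    using N0(2) by (intro emeasure_subadditive) auto
  also have "\<dots> = emeasure lborel (\<Union>n. B' n)"
    using N0(1) by simp
  also have "\<dots> \<le> (\<Sum>n. emeasure lborel (B' n))"
    by (intro emeasure_subadditive_countably) auto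
  also have "\<dots> = ennreal (L ^ DIM('a)) * (\<Sum>n. emeasure lborel (B n))"
    by (simp add: vol)
  also have "\<dots> \<le> ennreal (L ^ DIM('a)) * (emeasure lborel W + ennreal e')"
    using sumB by (rule mult_left_mono) simp
  also have "\<dots> = ennreal (L ^ DIM('a)) * emeasure lborel W + ennreal e"
    using L e by (simp add: distrib_left ennreal_mult' [symmetric] e'_def)
  finally show "emeasure lborel Q \<le> ennreal (L ^ DIM('a)) * emeasure lborel W + ennreal e" .
qed

text \<open>
  A map with Lipschitz constant \<open>1\<close> does not enlarge volumes; apply this to \<open>\<sigma>\<close> in both directions.
\<close>
lemma distr_isometric_involution:
  fixes \<sigma> :: "'a::euclidean_space \<Rightarrow> 'a"
  assumes iso: "\<And>x y. dist (\<sigma> x) (\<sigma> y) = dist x y" and inv: "\<And>x. \<sigma> (\<sigma> x) = x"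
  shows "distr lborel borel \<sigma> = lborel"
proof (rule measure_eqI)
  have "continuous_on UNIV \<sigma>"
    unfolding continuous_on_iff using iso by metis
  then have m[measurable]: "\<sigma> \<in> borel_measurable borel"
    by (rule borel_measurable_continuous_onI)
  have le: "emeasure lborel (\<sigma> -` A) \<le> emeasure lborel A" if A: "A \<in> sets borel" for A
  proof -
    have "emeasure lborel (\<sigma> -` A) \<le> ennreal (1 ^ DIM('a)) * emeasure lborel A"
    proof (rule emeasure_lipschitz_image_le[where T = \<sigma>])
      show "\<sigma> -` A \<in> sets borel" using measurable_sets[OF m A] by simp
      show "\<sigma> -` A \<subseteq> \<sigma> ` A" using inv by (metis image_eqI subsetI vimageD)
    qed (use A iso in auto)
    then show ?thesis by simp
  qed
  fix A :: "'a set" assume "A \<in> sets (distr lborel borel \<sigma>)"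
  then have A[measurable]: "A \<in> sets borel" by simp
  have "\<sigma> -` (\<sigma> -` A) = A" using inv by auto
  moreover have "\<sigma> -` A \<in> sets borel" using measurable_sets[OF m A] by simp
  ultimately have "emeasure lborel A \<le> emeasure lborel (\<sigma> -` A)"
    using le by metis
  with le[OF A] have "emeasure lborel (\<sigma> -` A) = emeasure lborel A" by (rule antisym)
  then show "emeasure (distr lborel borel \<sigma>) A = emeasure lborel A"
    by (simp add: emeasure_distr)
qed simp

section \<open>Reflections\<close>

text \<open>
  A vector \<open>v\<close> encodes the hyperplane orthogonal to \<open>v\<close> through \<open>c + v\<close>, so that vectors
  parametrize the hyperplanes missing \<open>c\<close>. The offset is the signed distance to it in
  multiples of \<open>v\<close>; it is \<open>-1\<close> at \<open>c\<close>, so the side of \<open>c\<close> is where it is at most \<open>0\<close>. For \<open>v = 0\<close>,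
  where \<open>0 / 0 = 0\<close>, the offset is \<open>-1\<close> everywhere and the reflection is the identity.
\<close>
definition hyperplane_offset :: "'a::euclidean_space \<Rightarrow> 'a \<Rightarrow> 'a \<Rightarrow> real" where
  "hyperplane_offset c v x = ((x - c) \<bullet> v) / (v \<bullet> v) - 1"

definition reflect :: "'a::euclidean_space \<Rightarrow> 'a \<Rightarrow> 'a \<Rightarrow> 'a" where
  "reflect c v x = x - (2 * hyperplane_offset c v x) *\<^sub>R v"

lemma hyperplane_offset_mult: "hyperplane_offset c v x * (v \<bullet> v) = (x - c) \<bullet> v - v \<bullet> v"
  by (cases "v = 0") (auto simp: hyperplane_offset_def field_simps)

lemma hyperplane_offset_diff:
  "(x - y) \<bullet> v = (hyperplane_offset c v x - hyperplane_offset c v y) * (v \<bullet> v)"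
  by (simp add: left_diff_distrib hyperplane_offset_mult inner_diff_left)

lemma hyperplane_offset_reflect: "v \<noteq> 0 \<Longrightarrow> hyperplane_offset c v (reflect c v x) = - hyperplane_offset c v x"
  unfolding reflect_def hyperplane_offset_def by (simp only: inner_diff_left inner_scaleR_left) (simp add: field_simps)

lemma reflect_0 [simp]: "reflect c 0 x = x"
  by (simp add: reflect_def)

lemma hyperplane_offset_0 [simp]: "hyperplane_offset c 0 x = - 1"
  by (simp add: hyperplane_offset_def)

lemma reflect_reflect [simp]: "reflect c v (reflect c v x) = x"
proof (cases "v = 0")
  case False
  have "reflect c v (reflect c v x) = reflect c v x - (2 * hyperplane_offset c v (reflect c v x)) *\<^sub>R v"
    by (simp add: reflect_def)
  then show ?thesis unfolding hyperplane_offset_reflect[OF False] by (simp add: reflect_def)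
qed simp

text \<open>
  The source of all monotonicity below: reflecting one of two points brings them further apart
  exactly when they lie strictly on the same side of the hyperplane.
\<close>
lemma dist_reflect_power2:
  "(dist x (reflect c v y))\<^sup>2 = (dist x y)\<^sup>2 + 4 * (hyperplane_offset c v x * hyperplane_offset c v y * (v \<bullet> v))"
proof -
  have sq: "(w + (2 * s) *\<^sub>R v) \<bullet> (w + (2 * s) *\<^sub>R v) = w \<bullet> w + 4 * s * (w \<bullet> v) + 4 * s\<^sup>2 * (v \<bullet> v)" for w and s :: real
    using inner_commute[of v w] by (simp add: inner_add_left inner_add_right power2_eq_square algebra_simps)
  define s where "s = hyperplane_offset c v y"
  have "x - reflect c v y = (x - y) + (2 * s) *\<^sub>R v" by (simp add: reflect_def s_def)
  then have "(dist x (reflect c v y))\<^sup>2 = ((x - y) + (2 * s) *\<^sub>R v) \<bullet> ((x - y) + (2 * s) *\<^sub>R v)"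
    by (simp only: dist_norm power2_norm_eq_inner)
  also have "\<dots> = (x - y) \<bullet> (x - y) + 4 * s * ((x - y) \<bullet> v) + 4 * s\<^sup>2 * (v \<bullet> v)"
    by (rule sq)
  also have "\<dots> = (dist x y)\<^sup>2 + 4 * (hyperplane_offset c v x * s * (v \<bullet> v))"
    unfolding hyperplane_offset_diff[of x y v c] s_def[symmetric]
    by (simp add: dist_norm power2_norm_eq_inner) (simp add: algebra_simps power2_eq_square)
  finally show ?thesis by (simp add: s_def)
qed

lemma dist_reflect_reflect [simp]: "dist (reflect c v x) (reflect c v y) = dist x y"
proof (cases "v = 0")
  case False
  have "(dist (reflect c v x) (reflect c v y))\<^sup>2 = (dist x y)\<^sup>2"
    using dist_reflect_power2[of "reflect c v x" c v y] dist_reflect_power2[of y c v x]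
    by (simp add: hyperplane_offset_reflect[OF False] dist_commute algebra_simps)
  then show ?thesis by simp
qed simp

lemma reflect_swap: "dist x (reflect c v y) = dist (reflect c v x) y"
  by (metis dist_reflect_reflect reflect_reflect)

lemma dist_le_dist_reflect:
  assumes "hyperplane_offset c v x \<le> 0" "hyperplane_offset c v y \<le> 0"
  shows "dist x y \<le> dist x (reflect c v y)"
proof (rule power2_le_imp_le)
  have "0 \<le> hyperplane_offset c v x * hyperplane_offset c v y * (v \<bullet> v)"
    using assms by (simp add: mult_nonpos_nonpos)
  then show "(dist x y)\<^sup>2 \<le> (dist x (reflect c v y))\<^sup>2"
    unfolding dist_reflect_power2 by simp
qed simp

lemma hyperplane_offset_center: "hyperplane_offset c v c = - 1"
  by (simp add: hyperplane_offset_def)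

lemma hyperplane_offset_le0_cases:
  "hyperplane_offset c v x \<le> 0 \<or> hyperplane_offset c v (reflect c v x) \<le> 0"
  by (cases "v = 0") (auto simp: hyperplane_offset_reflect)

lemma measurable_reflect [measurable]:
  "(\<lambda>(v, x). reflect c v x) \<in> borel_measurable (borel \<Otimes>\<^sub>M borel)"
  "(\<lambda>(v, x). hyperplane_offset c v x) \<in> borel_measurable (borel \<Otimes>\<^sub>M borel)"
  "reflect c v \<in> borel_measurable borel" "hyperplane_offset c v \<in> borel_measurable borel"
  "(\<lambda>v. reflect c v x) \<in> borel_measurable borel"
  unfolding reflect_def hyperplane_offset_def by measurable

lemma distr_reflect: "distr lborel borel (reflect c v) = lborel"
  by (rule distr_isometric_involution) auto

lemma nn_integral_reflect:
  assumes [measurable]: "h \<in> borel_measurable borel"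
  shows "(\<integral>\<^sup>+x. h (reflect c v x) \<partial>lborel) = (\<integral>\<^sup>+x. h x \<partial>lborel)"
proof -
  have "(\<integral>\<^sup>+x. h x \<partial>lborel) = (\<integral>\<^sup>+x. h x \<partial>distr lborel borel (reflect c v))" by (simp add: distr_reflect)
  also have "\<dots> = (\<integral>\<^sup>+x. h (reflect c v x) \<partial>lborel)" by (rule nn_integral_distr) auto
  finally show ?thesis by simp
qed

section \<open>Polarization\<close>

definition polarize :: "'a::euclidean_space \<Rightarrow> 'a \<Rightarrow> ('a \<Rightarrow> real) \<Rightarrow> 'a \<Rightarrow> real" where
  "polarize c v g x =
     (if hyperplane_offset c v x \<le> 0 then max (g x) (g (reflect c v x)) else min (g x) (g (reflect c v x)))"

lemma reflect_on_hyperplane: "hyperplane_offset c v x = 0 \<Longrightarrow> reflect c v x = x"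
  by (simp add: reflect_def)

lemma polarize_inside:
  assumes "hyperplane_offset c v x \<le> 0"
  shows "polarize c v g x = max (g x) (g (reflect c v x))"
    and "polarize c v g (reflect c v x) = min (g x) (g (reflect c v x))"
proof -
  show "polarize c v g x = max (g x) (g (reflect c v x))" using assms by (simp add: polarize_def)
  show "polarize c v g (reflect c v x) = min (g x) (g (reflect c v x))"
  proof (cases "v = 0 \<or> hyperplane_offset c v x = 0")
    case True
    then have "reflect c v x = x" by (auto simp: reflect_on_hyperplane)
    then show ?thesis by (simp add: polarize_def)
  next
    case False
    then show ?thesis using assms by (simp add: polarize_def hyperplane_offset_reflect min.commute)
  qed
qed

text \<open>
  On each pair of mirror points polarization either does nothing or exchanges the two values.
  Equimeasurability of \<open>g\<close> and its polarization follows by integrating over pairs.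
\<close>
lemma polarize_swap:
  "polarize c v g x = g x \<and> polarize c v g (reflect c v x) = g (reflect c v x) \<or>
   polarize c v g x = g (reflect c v x) \<and> polarize c v g (reflect c v x) = g x"
proof -
  have *: "polarize c v g x = g x \<and> polarize c v g (reflect c v x) = g (reflect c v x) \<or>
      polarize c v g x = g (reflect c v x) \<and> polarize c v g (reflect c v x) = g x"
    if "hyperplane_offset c v x \<le> 0" for x
    using polarize_inside[OF that, of g] by (cases "g x \<le> g (reflect c v x)") auto
  show ?thesis using hyperplane_offset_le0_cases[of c v x] *[of x] *[of "reflect c v x"] by auto
qed

lemma measurable_polarize [measurable]:
  assumes [measurable]: "g \<in> borel_measurable borel"
  shows "polarize c v g \<in> borel_measurable borel"
  unfolding polarize_def by measurable

lemma nn_integral_reflect_pair: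
  assumes [measurable]: "h \<in> borel_measurable borel"
  shows "(\<integral>\<^sup>+x. h x + h (reflect c v x) \<partial>lborel) = 2 * (\<integral>\<^sup>+x. h x \<partial>lborel)"
  by (subst nn_integral_add) (auto simp: nn_integral_reflect mult_2)

lemma ennreal_two_mult_le_cancel: "2 * (a::ennreal) \<le> 2 * b \<longleftrightarrow> a \<le> b"
  by (simp add: ennreal_mult_le_mult_iff)

text \<open>
  Reflections preserve volume, so integrals may be compared pair by pair. Summing over a
  point and its image on the whole space, rather than integrating over a half-space, makes it
  unnecessary to treat the hyperplane itself.
\<close>
lemma nn_integral_reflect_pair_mono:
  assumes [measurable]: "h \<in> borel_measurable borel" "k \<in> borel_measurable borel"
    and "\<And>x. h x + h (reflect c v x) \<le> k x + k (reflect c v x)"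
  shows "(\<integral>\<^sup>+x. h x \<partial>lborel) \<le> (\<integral>\<^sup>+x. k x \<partial>lborel)"
proof -
  have "(\<integral>\<^sup>+x. h x + h (reflect c v x) \<partial>lborel) \<le> (\<integral>\<^sup>+x. k x + k (reflect c v x) \<partial>lborel)"
    by (intro nn_integral_mono assms)
  then show ?thesis by (simp add: nn_integral_reflect_pair ennreal_two_mult_le_cancel)
qed

lemma nn_integral_polarize:
  assumes [measurable]: "g \<in> borel_measurable borel" "h \<in> borel_measurable borel"
  shows "(\<integral>\<^sup>+x. h (polarize c v g x) \<partial>lborel) = (\<integral>\<^sup>+x. h (g x) \<partial>lborel)"
proof -
  have "h (polarize c v g x) + h (polarize c v g (reflect c v x)) = h (g x) + h (g (reflect c v x))" for x
    using polarize_swap[of c v g x] by (auto simp: add.commute)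
  then show ?thesis
    by (intro antisym nn_integral_reflect_pair_mono[of _ _ c v]) auto
qed

lemma emeasure_polarize_superlevel:
  assumes [measurable]: "g \<in> borel_measurable borel"
  shows "emeasure lborel {x. polarize c v g x > t} = emeasure lborel {x. g x > t}"
proof -
  have eq: "emeasure lborel {x. f x > t} = (\<integral>\<^sup>+x. indicator {t<..} (f x) \<partial>lborel)"
    if [measurable]: "f \<in> borel_measurable borel" for f :: "'a \<Rightarrow> real"
  proof -
    have "(\<integral>\<^sup>+x. indicator {t<..} (f x) \<partial>lborel) = (\<integral>\<^sup>+x. indicator {x. f x > t} x \<partial>lborel)"
      by (intro nn_integral_cong) (auto simp: indicator_def)
    then show ?thesis by simp
  qed
  show ?thesis unfolding eq[OF assms] eq[OF measurable_polarize[OF assms]]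
    by (rule nn_integral_polarize) auto
qed

lemma polarize_mono_comp:
  assumes "\<And>x. g x \<in> S" and mono: "\<And>s t. s \<in> S \<Longrightarrow> t \<in> S \<Longrightarrow> s \<le> t \<Longrightarrow> k s \<le> k t"
  shows "polarize c v (\<lambda>x. k (g x)) x = k (polarize c v g x)"
proof -
  have "max (k s) (k t) = k (max s t)" "min (k s) (k t) = k (min s t)" if "s \<in> S" "t \<in> S" for s t
    using mono[OF that] mono[OF that(2,1)] by (auto simp: max_def min_def)
  then show ?thesis using assms(1) by (simp add: polarize_def)
qed

section \<open>Polarization lowers interactions\<close>

lemma powr_convex_comb:
  fixes p :: real
  assumes p: "p \<ge> 1" and l: "0 \<le> l" "l \<le> 1" and s: "0 \<le> s" and t: "0 \<le> t"
  shows "((1 - l) * s + l * t) powr p \<le> (1 - l) * s powr p + l * t powr p"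
proof -
  have pow: "x powr p \<le> x" if "0 \<le> x" "x \<le> 1" for x :: real
    using powr_mono'[of 1 p x] p that by (cases "x = 0") auto
  consider "s = 0" | "t = 0" | "s > 0" "t > 0" using s t by linarith
  then show ?thesis
  proof cases
    case 1
    then show ?thesis using p t l pow[of l] by (simp add: powr_mult mult_right_mono)
  next
    case 2
    then show ?thesis using p s l pow[of "1 - l"] by (simp add: powr_mult mult_right_mono)
  next
    case 3
    then show ?thesis using convex_onD[OF powr_convex[OF p], of l s t] l by simp
  qed
qed

lemma abs_powr_convex_comb:
  fixes p :: real
  assumes p: "p \<ge> 1" and l: "0 \<le> l" "l \<le> 1"
  shows "\<bar>(1 - l) * s + l * t\<bar> powr p \<le> (1 - l) * \<bar>s\<bar> powr p + l * \<bar>t\<bar> powr p"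
proof -
  have "\<bar>(1 - l) * s + l * t\<bar> \<le> (1 - l) * \<bar>s\<bar> + l * \<bar>t\<bar>"
    using l abs_triangle_ineq[of "(1 - l) * s" "l * t"] by (simp add: abs_mult)
  then have "\<bar>(1 - l) * s + l * t\<bar> powr p \<le> ((1 - l) * \<bar>s\<bar> + l * \<bar>t\<bar>) powr p"
    using p by (intro powr_mono2) auto
  also have "\<dots> \<le> (1 - l) * \<bar>s\<bar> powr p + l * \<bar>t\<bar> powr p"
    using powr_convex_comb[OF p l] by simp
  finally show ?thesis .
qed

text \<open>
  The differences \<open>a - d\<close> and \<open>b - c\<close> have the same sum as \<open>a - c\<close> and \<open>b - d\<close> and lie between
  them, so the claim is convexity of \<open>\<bar>t\<bar>\<^sup>p\<close>.
\<close>
lemma abs_powr_exchange: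
  fixes p :: real
  assumes p: "p \<ge> 1" and "b \<le> a" "c \<le> d"
  shows "\<bar>a - d\<bar> powr p + \<bar>b - c\<bar> powr p \<le> \<bar>a - c\<bar> powr p + \<bar>b - d\<bar> powr p"
proof (cases "a - c = b - d")
  case True
  then have "a = b" "c = d" using assms by linarith+
  then show ?thesis by simp
next
  case False
  define l where "l = (a - b) / ((a - c) - (b - d))"
  have den: "(a - c) - (b - d) > 0" using assms False by linarith
  have l: "0 \<le> l" "l \<le> 1" using assms den by (auto simp: l_def field_simps)
  have lm: "l * ((a - c) - (b - d)) = a - b" using den by (simp add: l_def)
  have 1: "(1 - l) * (b - d) + l * (a - c) = a - d"
    using lm by (simp add: algebra_simps)
  have 2: "(1 - l) * (a - c) + l * (b - d) = b - c"
    using lm by (simp add: algebra_simps)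
  show ?thesis
    using abs_powr_convex_comb[OF p l, of "b - d" "a - c"] abs_powr_convex_comb[OF p l, of "a - c" "b - d"]
    unfolding 1 2 by (simp add: algebra_simps)
qed

lemma ennreal_rearrangement2:
  fixes A B K L :: ennreal
  assumes "B \<le> A" "L \<le> K"
  shows "B * K + A * L \<le> A * K + B * L"
proof -
  obtain e where A: "A = B + e" using assms(1) le_iff_add by blast
  have "e * L \<le> e * K" using assms by (intro mult_left_mono) auto
  then show ?thesis unfolding A by (simp add: distrib_right add_ac add_left_mono)
qed

text \<open>
  The kernel takes values in \<^typ>\<open>ennreal\<close> so that it may be infinite at distance \<open>0\<close>; this keeps it
  monotone there, and the product with \<open>\<bar>u x - u x\<bar>\<^sup>p = 0\<close> is \<open>0\<close>.
\<close>
definition interaction :: "(real \<Rightarrow> ennreal) \<Rightarrow> real \<Rightarrow> ('a::euclidean_space \<Rightarrow> real) \<Rightarrow> ennreal" where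
  "interaction K p u =
     (\<integral>\<^sup>+x. (\<integral>\<^sup>+y. ennreal (\<bar>u x - u y\<bar> powr p) * K (dist x y) \<partial>lborel) \<partial>lborel)"

text \<open>
  Collect the four terms that arise from \<open>x\<close>, \<open>y\<close> and their mirror images. With \<open>x\<close> and \<open>y\<close> on the
  side of \<open>c\<close>, the terms at distance \<open>\<bar>x - y\<bar>\<close> carry the larger kernel value. Polarization
  either leaves the four values of \<open>u\<close> alone or exchanges the two sums of powers, and in the second
  case it moves the smaller sum to the larger kernel value.
\<close>
lemma interaction_polarize_le:
  fixes u :: "'a::euclidean_space \<Rightarrow> real"
  assumes p: "p \<ge> 1" and u[measurable]: "u \<in> borel_measurable borel"
    and K[measurable]: "K \<in> borel_measurable borel" and anti: "\<And>s t. 0 \<le> s \<Longrightarrow> s \<le> t \<Longrightarrow> K t \<le> K s"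
  shows "interaction K p (polarize c v u) \<le> interaction K p u"
proof -
  let ?r = "reflect c v"
  define e where "e w x y = ennreal (\<bar>w x - w y\<bar> powr p) * K (dist x y)" for w and x y :: 'a
  have [measurable]: "(\<lambda>(x,y). e w x y) \<in> borel_measurable (borel \<Otimes>\<^sub>M borel)"
    if [measurable]: "w \<in> borel_measurable borel" for w
    unfolding e_def by measurable
  define S where "S w x y = e w x y + e w x (?r y) + (e w (?r x) y + e w (?r x) (?r y))" for w x y
  have four: "(\<integral>\<^sup>+x. (\<integral>\<^sup>+y. S w x y \<partial>lborel) \<partial>lborel) = 2 * (2 * interaction K p w)"
    if [measurable]: "w \<in> borel_measurable borel" for w
  proof -
    define F where "F x = (\<integral>\<^sup>+y. e w x y \<partial>lborel)" for x
    have [measurable]: "F \<in> borel_measurable borel" unfolding F_def by measurable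
    have "(\<integral>\<^sup>+y. S w x y \<partial>lborel) = 2 * (F x + F (?r x))" for x
      unfolding S_def F_def by (subst nn_integral_add) (auto simp: nn_integral_reflect_pair distrib_left)
    then have "(\<integral>\<^sup>+x. (\<integral>\<^sup>+y. S w x y \<partial>lborel) \<partial>lborel) = (\<integral>\<^sup>+x. 2 * (F x + F (?r x)) \<partial>lborel)"
      by simp
    also have "\<dots> = 2 * (\<integral>\<^sup>+x. F x + F (?r x) \<partial>lborel)"
      by (rule nn_integral_cmult) measurable
    also have "(\<integral>\<^sup>+x. F x + F (?r x) \<partial>lborel) = 2 * (\<integral>\<^sup>+x. F x \<partial>lborel)"
      by (rule nn_integral_reflect_pair) measurable
    finally have "(\<integral>\<^sup>+x. (\<integral>\<^sup>+y. S w x y \<partial>lborel) \<partial>lborel) = 2 * (2 * (\<integral>\<^sup>+x. F x \<partial>lborel))" .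
    then show ?thesis by (simp add: interaction_def F_def e_def)
  qed
  \<comment> \<open>By symmetry the pointwise comparison is needed for \<open>x\<close> and \<open>y\<close> on the side of \<open>c\<close> only.\<close>
  have Ssym: "S w (?r x) y = S w x y" "S w x (?r y) = S w x y" for w x y
    by (simp_all add: S_def ac_simps)
  have key: "S (polarize c v u) x y \<le> S u x y"
    if xy: "hyperplane_offset c v x \<le> 0" "hyperplane_offset c v y \<le> 0" for x y
  proof -
    define k1 k2 where "k1 = K (dist x y)" and "k2 = K (dist x (?r y))"
    have k: "k2 \<le> k1" unfolding k1_def k2_def using xy by (intro anti dist_le_dist_reflect) auto
    have S: "S w x y = ennreal (\<bar>w x - w y\<bar> powr p + \<bar>w (?r x) - w (?r y)\<bar> powr p) * k1
       + ennreal (\<bar>w x - w (?r y)\<bar> powr p + \<bar>w (?r x) - w y\<bar> powr p) * k2" for w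
      unfolding S_def e_def k1_def k2_def reflect_swap[symmetric]
      by (simp add: distrib_left distrib_right ac_simps)
    note pol = polarize_inside[OF xy(1), of u] polarize_inside[OF xy(2), of u]
    show ?thesis
    proof (cases "(u x \<ge> u (?r x) \<longleftrightarrow> u y \<ge> u (?r y)) \<or> u x = u (?r x) \<or> u y = u (?r y)")
      case True
      then show ?thesis unfolding S pol
        by (auto simp: max_def min_def add.commute)
    next
      case False
      define A where "A = ennreal (\<bar>u x - u y\<bar> powr p + \<bar>u (?r x) - u (?r y)\<bar> powr p)"
      define B where "B = ennreal (\<bar>u x - u (?r y)\<bar> powr p + \<bar>u (?r x) - u y\<bar> powr p)"
      have "B \<le> A"
        using False abs_powr_exchange[OF p, of "u (?r x)" "u x" "u y" "u (?r y)"]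
          abs_powr_exchange[OF p, of "u x" "u (?r x)" "u (?r y)" "u y"]
        unfolding A_def B_def by (intro ennreal_leI) auto
      then have "B * k1 + A * k2 \<le> A * k1 + B * k2" using k by (rule ennreal_rearrangement2)
      moreover have "S (polarize c v u) x y = B * k1 + A * k2"
        using False unfolding S pol A_def B_def by (auto simp: max_def min_def add.commute)
      ultimately show ?thesis unfolding S A_def B_def by simp
    qed
  qed
  have "S (polarize c v u) x y \<le> S u x y" for x y
    using hyperplane_offset_le0_cases[of c v x] hyperplane_offset_le0_cases[of c v y] key[of x y]
      key[of "?r x" y] key[of x "?r y"] key[of "?r x" "?r y"] unfolding Ssym by blast
  then have "2 * (2 * interaction K p (polarize c v u)) \<le> 2 * (2 * interaction K p u)"
    unfolding four[OF u, symmetric] four[OF measurable_polarize[OF u], symmetric]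
    by (intro nn_integral_mono)
  then show ?thesis by (simp only: ennreal_two_mult_le_cancel)
qed

section \<open>The reflections that send a point to a given set\<close>

lemma dist_center_le_dist_reflect:
  assumes "hyperplane_offset c v x \<le> 0"
  shows "dist c x \<le> dist c (reflect c v x)"
  using dist_le_dist_reflect[of c v c x] assms by (simp add: hyperplane_offset_center)

text \<open>
  The reflection that exchanges \<open>x\<close> and \<open>y\<close> has the perpendicular bisector as its hyperplane; \<open>v\<close> is
  the foot of the perpendicular from \<open>c\<close>. Its length is
  \<open>(\<bar>y - c\<bar>\<^sup>2 - \<bar>x - c\<bar>\<^sup>2) / (2 \<bar>x - y\<bar>)\<close>, which is at least \<open>d / 2\<close> because
  \<open>\<bar>x - y\<bar> \<le> \<bar>x - c\<bar> + \<bar>y - c\<bar>\<close>.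
\<close>
lemma ex_reflect_eq:
  fixes c x y :: "'a::euclidean_space"
  assumes d: "d > 0" "dist c x + d \<le> dist c y" "dist c y \<le> R"
  shows "\<exists>v. d / 2 \<le> norm v \<and> norm v \<le> R \<and> reflect c v x = y"
proof -
  define X Y w where "X = x - c" and "Y = y - c" and "w = x - y"
  have dX: "dist c x = norm X" and dY: "dist c y = norm Y" and Y: "Y = X - w"
    by (simp_all add: X_def Y_def w_def dist_norm norm_minus_commute)
  have w0: "w \<noteq> 0" using d by (auto simp: w_def)
  \<comment> \<open>The normal is a multiple of \<open>x - y\<close>; this factor puts the midpoint on the hyperplane.\<close>
  define \<beta> where "\<beta> = (X \<bullet> w) / (w \<bullet> w) - 1 / 2"
  have ww: "w \<bullet> w > 0" using w0 by simp
  have b: "2 * \<beta> * (w \<bullet> w) = (norm X)\<^sup>2 - (norm Y)\<^sup>2"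
    using ww unfolding Y \<beta>_def power2_norm_eq_inner
    by (simp add: inner_diff_left inner_diff_right inner_commute[of w X] field_simps)
  have XY: "(norm X)\<^sup>2 < (norm Y)\<^sup>2" using d unfolding dX dY by (intro power_strict_mono) auto
  then have b0: "\<beta> < 0" using b ww by (smt (verit) mult_nonneg_nonneg)
  define v where "v = \<beta> *\<^sub>R w"
  have nw: "w \<bullet> w = norm w * norm w" by (simp add: power2_norm_eq_inner[symmetric] power2_eq_square)
  have nv: "norm v * (2 * norm w) = (norm Y - norm X) * (norm Y + norm X)"
    using b b0 unfolding v_def nw by (simp add: power2_eq_square algebra_simps)
  have n1: "norm w \<le> norm Y + norm X" using Y norm_triangle_ineq4[of X Y] by simp
  have n2: "norm Y - norm X \<le> norm w" using norm_triangle_ineq2[of Y X] Y by simp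
  have nw0: "norm w > 0" using w0 by simp
  have "d * norm w \<le> (norm Y - norm X) * (norm Y + norm X)"
    using n1 d unfolding dX dY by (intro mult_mono) auto
  then have "d * norm w \<le> (2 * norm v) * norm w" using nv by (simp add: mult_ac)
  then have l1: "d / 2 \<le> norm v" using nw0 by simp
  have "(norm Y - norm X) * (norm Y + norm X) \<le> norm w * (2 * R)"
    using n2 d unfolding dX dY by (intro mult_mono) auto
  then have "norm v * (2 * norm w) \<le> R * (2 * norm w)" unfolding nv by (simp add: mult_ac)
  then have l2: "norm v \<le> R" using nw0 by simp
  have "hyperplane_offset c v x * \<beta> = 1 / 2"
  proof -
    let ?s = "hyperplane_offset c v x"
    have half: "X \<bullet> w - \<beta> * (w \<bullet> w) = (1 / 2) * (w \<bullet> w)" using ww by (simp add: \<beta>_def field_simps)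
    have "\<beta> * ((?s * \<beta>) * (w \<bullet> w)) = \<beta> * (X \<bullet> w - \<beta> * (w \<bullet> w))"
      using hyperplane_offset_mult[of c v x] by (simp add: v_def X_def algebra_simps)
    then have "(?s * \<beta>) * (w \<bullet> w) = (1 / 2) * (w \<bullet> w)"
      unfolding half using b0 by (metis mult_cancel_left order_less_irrefl)
    then show ?thesis using ww by (metis mult_cancel_right order_less_irrefl)
  qed
  then have "2 * hyperplane_offset c v x * \<beta> = 1" by simp
  moreover have "(2 * hyperplane_offset c v x) *\<^sub>R v = (2 * hyperplane_offset c v x * \<beta>) *\<^sub>R w"
    by (simp add: v_def)
  ultimately have "reflect c v x = x - w" unfolding reflect_def by simp
  then have "reflect c v x = y" by (simp add: w_def)
  with l1 l2 show ?thesis by blast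
qed

lemma norm_direction_diff_le:
  fixes v w :: "'a::real_normed_vector"
  assumes "r > 0" "r \<le> norm v" "r \<le> norm w"
  shows "norm (v /\<^sub>R norm v - w /\<^sub>R norm w) \<le> 2 / r * norm (v - w)"
proof -
  have pos: "norm v > 0" "norm w > 0" using assms by linarith+
  have eq: "v /\<^sub>R norm v - w /\<^sub>R norm w = (v - w) /\<^sub>R norm v + ((norm w - norm v) / norm v) *\<^sub>R (w /\<^sub>R norm w)"
  proof -
    have "(norm w - norm v) / norm v * inverse (norm w) = inverse (norm v) - inverse (norm w)"
      using pos by (simp add: field_simps)
    then show ?thesis by (simp add: scaleR_diff_left scaleR_diff_right)
  qed
  have "norm (v /\<^sub>R norm v - w /\<^sub>R norm w) \<le> norm ((v - w) /\<^sub>R norm v) + norm (((norm w - norm v) / norm v) *\<^sub>R (w /\<^sub>R norm w))"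
    unfolding eq by (rule norm_triangle_ineq)
  also have "\<dots> = norm (v - w) / norm v + \<bar>norm w - norm v\<bar> / norm v"
  proof -
    have w1: "norm (w /\<^sub>R norm w) = 1" using pos by simp
    show ?thesis unfolding norm_scaleR[of _ "w /\<^sub>R norm w"] w1
      using pos by (simp add: abs_mult divide_inverse mult.commute)
  qed
  also have "\<dots> \<le> norm (v - w) / norm v + norm (v - w) / norm v"
    using norm_triangle_ineq3[of w v] by (intro add_left_mono divide_right_mono) (auto simp: norm_minus_commute)
  also have "\<dots> = 2 * norm (v - w) / norm v" by simp
  also have "\<dots> \<le> 2 * norm (v - w) / r" using assms pos by (intro divide_left_mono) auto
  finally show ?thesis by simp
qed

text \<open>
  The reflection depends on \<open>v\<close> through \<open>v\<close> itself and the direction \<open>v / \<bar>v\<bar>\<close>; the latter is a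
  Lipschitz function as long as \<open>v\<close> stays away from \<open>0\<close>.
\<close>
lemma reflect_lipschitz_in_normal:
  fixes c x :: "'a::euclidean_space"
  assumes r: "r > 0" "r \<le> norm v" "r \<le> norm w" and x: "dist c x \<le> R"
  shows "dist (reflect c v x) (reflect c w x) \<le> (8 * R / r + 2) * dist v w"
proof -
  define X where "X = x - c"
  have X: "norm X \<le> R" using x by (simp add: X_def dist_norm norm_minus_commute)
  define n where "n u = u /\<^sub>R norm u" for u :: 'a
  have rn: "reflect c u x = x - 2 *\<^sub>R ((X \<bullet> n u) *\<^sub>R n u) + 2 *\<^sub>R u" if "r \<le> norm u" for u
  proof -
    have "u \<bullet> u = norm u * norm u" by (simp add: power2_norm_eq_inner[symmetric] power2_eq_square)
    moreover have "norm u > 0" using r(1) that by linarith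
    ultimately show ?thesis unfolding reflect_def hyperplane_offset_def X_def[symmetric] n_def
      by (simp add: algebra_simps divide_inverse)
  qed
  have n1: "norm (n u) = 1" if "r \<le> norm u" for u
  proof -
    have "norm u > 0" using r(1) that by linarith
    then show ?thesis by (simp add: n_def)
  qed
  have D: "reflect c v x - reflect c w x = 2 *\<^sub>R ((X \<bullet> (n w - n v)) *\<^sub>R n w + (X \<bullet> n v) *\<^sub>R (n w - n v)) + 2 *\<^sub>R (v - w)"
    unfolding rn[OF r(2)] rn[OF r(3)] by (simp add: algebra_simps)
  have "norm ((X \<bullet> (n w - n v)) *\<^sub>R n w + (X \<bullet> n v) *\<^sub>R (n w - n v)) \<le> \<bar>X \<bullet> (n w - n v)\<bar> + \<bar>X \<bullet> n v\<bar> * norm (n w - n v)"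
    by (rule order_trans[OF norm_triangle_ineq]) (simp add: n1 r)
  also have "\<dots> \<le> norm X * norm (n w - n v) + norm X * norm (n v) * norm (n w - n v)"
    by (intro add_mono mult_right_mono Cauchy_Schwarz_ineq2) auto
  also have "\<dots> = 2 * norm X * norm (n w - n v)" by (simp add: n1 r)
  also have "\<dots> \<le> 2 * R * (2 / r * norm (w - v))"
    using norm_direction_diff_le[OF r(1,3,2)] X norm_ge_zero[of X] order_trans[OF norm_ge_zero X] unfolding n_def by (intro mult_mono) auto
  finally have *: "norm ((X \<bullet> (n w - n v)) *\<^sub>R n w + (X \<bullet> n v) *\<^sub>R (n w - n v)) \<le> 4 * R / r * norm (v - w)"
    by (simp add: norm_minus_commute)
  have "dist (reflect c v x) (reflect c w x) \<le> 2 * norm ((X \<bullet> (n w - n v)) *\<^sub>R n w + (X \<bullet> n v) *\<^sub>R (n w - n v)) + 2 * norm (v - w)"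
    unfolding dist_norm D by (rule order_trans[OF norm_triangle_ineq]) simp
  also have "\<dots> \<le> 2 * (4 * R / r * norm (v - w)) + 2 * norm (v - w)" using * by linarith
  also have "\<dots> = (8 * R / r + 2) * dist v w" by (simp add: dist_norm algebra_simps)
  finally show ?thesis .
qed

text \<open>
  Every \<open>y\<close> whose distance to \<open>c\<close> exceeds that of \<open>x\<close> by \<open>d\<close> is the mirror image of \<open>x\<close> for some normal
  \<open>v\<close>. If there are many targets \<open>y\<close> in \<open>P\<close>, there must therefore be many such normals. The
  gap \<open>d\<close> keeps \<open>v\<close> away from \<open>0\<close>, where the Lipschitz bound fails.
\<close>
lemma emeasure_le_emeasure_reflecting_normals:
  fixes c x :: "'a::euclidean_space"
  assumes d: "d > 0" and R: "R > 0" and x: "dist c x \<le> R" and P: "P \<in> sets borel" "P \<subseteq> ball c R"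
  shows "emeasure lborel (P \<inter> {y. dist c x + d \<le> dist c y}) \<le>
    ennreal ((16 * R / d + 2) ^ DIM('a)) * emeasure lborel {v. d / 2 \<le> norm v \<and> norm v \<le> R \<and> reflect c v x \<in> P}"
proof (rule emeasure_lipschitz_image_le)
  have [measurable]: "P \<in> sets borel" by (rule P)
  let ?W = "{v. d / 2 \<le> norm v \<and> norm v \<le> R \<and> reflect c v x \<in> P}"
  show "?W \<in> sets borel" by measurable
  show "P \<inter> {y. dist c x + d \<le> dist c y} \<in> sets borel" by measurable
  show "P \<inter> {y. dist c x + d \<le> dist c y} \<subseteq> (\<lambda>v. reflect c v x) ` ?W"
  proof
    fix y assume y: "y \<in> P \<inter> {y. dist c x + d \<le> dist c y}"
    then have "dist c y \<le> R" using P(2) by (auto simp: subset_iff less_imp_le)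
    then obtain v where "d / 2 \<le> norm v" "norm v \<le> R" "reflect c v x = y"
      using ex_reflect_eq[of d c x y R] d y by auto
    then show "y \<in> (\<lambda>v. reflect c v x) ` ?W" using y by auto
  qed
  show "0 < 16 * R / d + 2" using d R by (simp add: add_pos_pos)
  show "dist (reflect c v x) (reflect c w x) \<le> (16 * R / d + 2) * dist v w" if "v \<in> ?W" "w \<in> ?W" for v w
    using reflect_lipschitz_in_normal[of "d/2" v w c x R] that d x by simp
qed

section \<open>Symmetric decreasing rearrangement of bounded functions\<close>

definition superlevel_measure :: "('a::euclidean_space \<Rightarrow> real) \<Rightarrow> real \<Rightarrow> real" where
  "superlevel_measure g t = measure lborel {x. g x > t}"

text \<open>
  The set \<open>{x. rearrange c g x > t}\<close> is to be the ball about \<open>c\<close> with the volume of \<open>{x. g x > t}\<close>,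
  for \<open>t \<ge> 0\<close>; a point belongs to that ball iff the ball through the point is smaller than
  the level set. Inserting \<open>0\<close> gives the value at points outside all these balls.
\<close>
definition rearrange :: "'a::euclidean_space \<Rightarrow> ('a \<Rightarrow> real) \<Rightarrow> 'a \<Rightarrow> real" where
  "rearrange c g x = Sup (insert 0 {t. 0 \<le> t \<and> measure lborel (ball c (dist c x)) < superlevel_measure g t})"

lemma emeasure_subball_eq:
  fixes c :: "'a::euclidean_space"
  assumes "m \<ge> 0"
  shows "emeasure lborel {x. measure lborel (ball c (dist c x)) < m} = ennreal m"
proof -
  define N where "N = DIM('a)"
  define w where "w = unit_ball_vol (real N)"
  have w: "w > 0" by (simp add: w_def)
  define s where "s = root N (m / w)"
  have N: "N > 0" by (simp add: N_def)
  have s: "s \<ge> 0" "s ^ N = m / w" using assms w N by (auto simp: s_def)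
  have "measure lborel (ball c (dist c x)) < m \<longleftrightarrow> x \<in> ball c s" for x
  proof -
    have "measure lborel (ball c (dist c x)) < m \<longleftrightarrow> dist c x ^ N < s ^ N"
      using w by (simp add: content_ball w_def[symmetric] N_def[symmetric] s(2) field_simps)
    also have "\<dots> \<longleftrightarrow> dist c x < s"
      using s(1) N by (metis power_less_imp_less_base power_strict_mono zero_le_dist)
    finally show ?thesis by simp
  qed
  then have "{x. measure lborel (ball c (dist c x)) < m} = ball c s" by blast
  moreover have "emeasure lborel (ball c s) = ennreal m"
    using s w by (simp add: emeasure_ball N_def[symmetric] w_def[symmetric])
  ultimately show ?thesis by simp
qed

lemma fmeasurable_ball: "ball c R \<in> fmeasurable lborel"
  using emeasure_lborel_ball_finite[of c R] by (simp add: fmeasurable_def top.not_eq_extremum)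

definition unit_profile :: "'a::euclidean_space \<Rightarrow> real \<Rightarrow> ('a \<Rightarrow> real) \<Rightarrow> bool" where
  "unit_profile c R g \<longleftrightarrow> g \<in> borel_measurable borel \<and> (\<forall>x. 0 \<le> g x \<and> g x < 1) \<and>
     (\<forall>x. R \<le> dist c x \<longrightarrow> g x = 0)"

context
  fixes c :: "'a::euclidean_space" and R :: real and g :: "'a \<Rightarrow> real"
  assumes profile: "unit_profile c R g"
begin

lemma profile_measurable [measurable]: "g \<in> borel_measurable borel"
  using profile by (simp add: unit_profile_def)

lemma profile_bounds: "0 \<le> g x" "g x < 1"
  using profile by (auto simp: unit_profile_def)

lemma profile_outside: "R \<le> dist c x \<Longrightarrow> g x = 0"
  using profile by (auto simp: unit_profile_def)

lemma profile_superlevel_subset: "0 \<le> t \<Longrightarrow> {x. g x > t} \<subseteq> ball c R"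
  using profile_outside by (smt (verit) mem_Collect_eq mem_ball subsetI)

lemma profile_superlevel_fmeasurable: "0 \<le> t \<Longrightarrow> {x. g x > t} \<in> fmeasurable lborel"
  by (rule fmeasurableI2[OF fmeasurable_ball profile_superlevel_subset]) auto

lemma emeasure_profile_superlevel:
  "0 \<le> t \<Longrightarrow> emeasure lborel {x. g x > t} = ennreal (superlevel_measure g t)"
  unfolding superlevel_measure_def
  using profile_superlevel_fmeasurable by (intro emeasure_eq_measure2 fmeasurableD2) (auto simp: fmeasurableD2)

lemma superlevel_measure_mono: "0 \<le> s \<Longrightarrow> s \<le> t \<Longrightarrow> superlevel_measure g t \<le> superlevel_measure g s"
  unfolding superlevel_measure_def
  using profile_superlevel_fmeasurable[of s] by (intro measure_mono_fmeasurable) auto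

lemma superlevel_measure_ge_1: "1 \<le> t \<Longrightarrow> superlevel_measure g t = 0"
proof -
  assume "1 \<le> t"
  then have "{x. g x > t} = {}" using profile_bounds(2) by (smt (verit) Collect_empty_eq)
  then show ?thesis by (simp add: superlevel_measure_def)
qed

text \<open>
  The level sets \<open>{x. g x > s}\<close> increase to \<open>{x. g x > t}\<close> as \<open>s\<close> decreases to \<open>t\<close>. This is what makes the
  supremum in the definition of the rearrangement have exactly the right strict level sets.
\<close>
lemma superlevel_measure_right_continuous:
  assumes t: "0 \<le> t" and m: "m < superlevel_measure g t"
  shows "\<exists>s>t. m < superlevel_measure g s"
proof -
  have "(\<lambda>n. measure lborel {x. g x > t + 1 / real (Suc n)}) \<longlonglongrightarrow> measure lborel (\<Union>n. {x. g x > t + 1 / real (Suc n)})"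
  proof (rule Lim_measure_incseq)
    show "incseq (\<lambda>n. {x. g x > t + 1 / real (Suc n)})"
    proof (rule incseq_SucI, safe)
      fix n x assume "g x > t + 1 / real (Suc n)"
      moreover have "1 / real (Suc (Suc n)) \<le> 1 / real (Suc n)" by (intro divide_left_mono) auto
      ultimately show "g x > t + 1 / real (Suc (Suc n))" by linarith
    qed
    have "emeasure lborel (\<Union>n. {x. g x > t + 1 / real (Suc n)}) \<le> emeasure lborel (ball c R)"
    proof (intro emeasure_mono UN_least)
      show "{x. g x > t + 1 / real (Suc n)} \<subseteq> ball c R" for n
        using t by (intro profile_superlevel_subset) auto
    qed auto
    then show "emeasure lborel (\<Union>n. {x. g x > t + 1 / real (Suc n)}) \<noteq> \<infinity>"
      by (metis emeasure_lborel_ball_finite infinity_ennreal_def leD)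
  qed auto
  also have "(\<Union>n. {x. g x > t + 1 / real (Suc n)}) = {x. g x > t}"
  proof safe
    fix x n assume "g x > t + 1 / real (Suc n)"
    then show "g x > t" by (smt (verit) divide_nonneg_nonneg of_nat_0_le_iff)
  next
    fix x assume "g x > t"
    then obtain n where "1 / real (Suc n) < g x - t" using nat_approx_posE[of "g x - t"] by auto
    then show "x \<in> (\<Union>n. {x. g x > t + 1 / real (Suc n)})" by (auto intro!: exI[of _ n])
  qed
  finally have "(\<lambda>n. superlevel_measure g (t + 1 / real (Suc n))) \<longlonglongrightarrow> superlevel_measure g t"
    by (simp add: superlevel_measure_def)
  from order_tendstoD(1)[OF this m] obtain n where "m < superlevel_measure g (t + 1 / real (Suc n))"
    by (auto simp: eventually_sequentially)
  then show ?thesis by (intro exI[of _ "t + 1 / real (Suc n)"]) simp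
qed

lemma rearrange_levels_less_1:
  "t \<in> {t. 0 \<le> t \<and> measure lborel (ball c (dist c x)) < superlevel_measure g t} \<Longrightarrow> t < 1"
  using superlevel_measure_ge_1[of t] by (force simp: not_less)

lemma bdd_above_rearrange_levels:
  "bdd_above (insert 0 {t. 0 \<le> t \<and> measure lborel (ball c (dist c x)) < superlevel_measure g t})"
  using rearrange_levels_less_1[of _ x] by (intro bdd_aboveI[of _ 1]) force

lemma rearrange_gt_iff:
  assumes t: "0 \<le> t"
  shows "t < rearrange c g x \<longleftrightarrow> measure lborel (ball c (dist c x)) < superlevel_measure g t"
proof
  assume "t < rearrange c g x"
  then obtain s where s: "s \<in> insert 0 {t. 0 \<le> t \<and> measure lborel (ball c (dist c x)) < superlevel_measure g t}" "t < s"
    unfolding rearrange_def using bdd_above_rearrange_levels[of x] by (subst (asm) less_cSup_iff) auto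
  then have "measure lborel (ball c (dist c x)) < superlevel_measure g s" using t by auto
  also have "\<dots> \<le> superlevel_measure g t" using s(2) t by (intro superlevel_measure_mono) auto
  finally show "measure lborel (ball c (dist c x)) < superlevel_measure g t" .
next
  assume "measure lborel (ball c (dist c x)) < superlevel_measure g t"
  then obtain s where s: "s > t" "measure lborel (ball c (dist c x)) < superlevel_measure g s"
    using superlevel_measure_right_continuous[OF t] by blast
  have "s \<le> rearrange c g x" unfolding rearrange_def
    using s t by (intro cSup_upper bdd_above_rearrange_levels) auto
  then show "t < rearrange c g x" using s(1) by simp
qed

lemma rearrange_nonneg: "0 \<le> rearrange c g x"
  unfolding rearrange_def by (intro cSup_upper bdd_above_rearrange_levels) auto

lemma rearrange_le_1: "rearrange c g x \<le> 1"
  unfolding rearrange_def using rearrange_levels_less_1[of _ x] by (intro cSup_least) force+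

lemma rearrange_measurable [measurable]: "rearrange c g \<in> borel_measurable borel"
proof (rule borel_measurableI_greater)
  fix t
  show "{x \<in> space borel. t < rearrange c g x} \<in> sets borel"
  proof (cases "0 \<le> t")
    case True
    have "{x. t < rearrange c g x} = {x. unit_ball_vol DIM('a) * dist c x ^ DIM('a) < superlevel_measure g t}"
      using rearrange_gt_iff[OF True] by (simp add: content_ball)
    also have "\<dots> \<in> sets borel" by measurable
    finally show ?thesis by simp
  next
    case False
    then have "{x. t < rearrange c g x} = UNIV" using rearrange_nonneg by (force simp: not_le intro: less_le_trans)
    then show ?thesis by simp
  qed
qed

lemma emeasure_rearrange_superlevel:
  assumes "0 \<le> t"
  shows "emeasure lborel {x. rearrange c g x > t} = emeasure lborel {x. g x > t}"
  unfolding rearrange_gt_iff[OF assms] emeasure_profile_superlevel[OF assms]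
  by (rule emeasure_subball_eq) (simp add: superlevel_measure_def)

lemma rearrange_antimono:
  assumes "dist c x \<le> dist c y"
  shows "rearrange c g y \<le> rearrange c g x"
proof (rule ccontr)
  assume "\<not> rearrange c g y \<le> rearrange c g x"
  then have "measure lborel (ball c (dist c y)) < superlevel_measure g (rearrange c g x)"
    using rearrange_gt_iff[OF rearrange_nonneg[of x], of y] by simp
  moreover have "measure lborel (ball c (dist c x)) \<le> measure lborel (ball c (dist c y))"
    using assms by (simp add: content_ball power_mono)
  ultimately show False
    using rearrange_gt_iff[OF rearrange_nonneg[of x], of x] by simp
qed

lemma rearrange_eq_0:
  assumes "superlevel_measure g 0 \<le> measure lborel (ball c r)" "0 \<le> r" "r \<le> dist c x"
  shows "rearrange c g x = 0"
proof -
  have "measure lborel (ball c r) \<le> measure lborel (ball c (dist c x))"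
    using assms by (simp add: content_ball power_mono)
  then have "\<not> 0 < rearrange c g x" using rearrange_gt_iff[of 0 x] assms by simp
  then show ?thesis using rearrange_nonneg[of x] by simp
qed

lemma rearrange_outside:
  assumes R: "0 \<le> R" and x: "R \<le> dist c x"
  shows "rearrange c g x = 0"
proof (rule rearrange_eq_0[OF _ R x])
  show "superlevel_measure g 0 \<le> measure lborel (ball c R)"
    unfolding superlevel_measure_def
    using profile_superlevel_subset[of 0] by (intro measure_mono_fmeasurable fmeasurable_ball) auto
qed

text \<open>
  The level sets \<open>{x. g x > 1 - 1/n}\<close> shrink to the empty set, so their volumes drop below that of the
  ball through \<open>x\<close>. At \<open>c\<close> itself this ball is empty and the value \<open>1\<close> does occur, namely when \<open>g\<close> is
  not essentially bounded away from \<open>1\<close>.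
\<close>
lemma rearrange_less_1:
  assumes "x \<noteq> c"
  shows "rearrange c g x < 1"
proof (rule ccontr)
  assume "\<not> rearrange c g x < 1"
  then have "1 \<le> rearrange c g x" by simp
  have *: "measure lborel (ball c (dist c x)) < superlevel_measure g (1 - 1 / real (Suc n))" for n
  proof -
    have "1 - 1 / real (Suc n) < 1" "0 \<le> 1 - 1 / real (Suc n)" by simp_all
    then show ?thesis using \<open>1 \<le> rearrange c g x\<close> rearrange_gt_iff[of "1 - 1 / real (Suc n)" x] by linarith
  qed
  have "(\<lambda>n. measure lborel {x. g x > 1 - 1 / real (Suc n)}) \<longlonglongrightarrow> measure lborel (\<Inter>n. {x. g x > 1 - 1 / real (Suc n)})"
  proof (rule Lim_measure_decseq)
    show "decseq (\<lambda>n. {x. g x > 1 - 1 / real (Suc n)})"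
    proof (rule decseq_SucI, safe)
      fix n x assume "g x > 1 - 1 / real (Suc (Suc n))"
      moreover have "1 / real (Suc (Suc n)) \<le> 1 / real (Suc n)" by (intro divide_left_mono) auto
      ultimately show "g x > 1 - 1 / real (Suc n)" by linarith
    qed
    show "emeasure lborel {x. g x > 1 - 1 / real (Suc n)} \<noteq> \<infinity>" for n
      by (subst emeasure_profile_superlevel) auto
  qed auto
  also have "(\<Inter>n. {x. g x > 1 - 1 / real (Suc n)}) = {}"
  proof (safe, simp)
    fix x assume *: "\<forall>n. 1 - 1 / (1 + real n) < g x"
    obtain n where "1 / real (Suc n) < 1 - g x" using nat_approx_posE[of "1 - g x"] profile_bounds(2)[of x] by auto
    with *[rule_format, of n] show False by simp
  qed
  finally have "(\<lambda>n. superlevel_measure g (1 - 1 / real (Suc n))) \<longlonglongrightarrow> 0"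
    by (simp add: superlevel_measure_def)
  then have "measure lborel (ball c (dist c x)) \<le> 0"
    using * by (intro LIMSEQ_le_const) (auto intro!: exI[of _ 0] less_imp_le)
  then have "dist c x \<le> 0" by (metis content_ball_gt_0_iff not_le)
  then show False using assms by simp
qed

lemma unit_profile_polarize: "unit_profile c R (polarize c v g)"
proof -
  have out: "polarize c v g x = 0" if "R \<le> dist c x" for x
  proof (cases "hyperplane_offset c v x \<le> 0")
    case True
    then have "R \<le> dist c (reflect c v x)" using dist_center_le_dist_reflect[OF True] that by linarith
    then show ?thesis using that by (simp add: polarize_def profile_outside)
  next
    case False
    then show ?thesis using that profile_bounds(1)[of "reflect c v x"] by (simp add: polarize_def profile_outside)
  qed
  have "0 \<le> polarize c v g x \<and> polarize c v g x < 1" for x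
    using polarize_swap[of c v g x] profile_bounds[of x] profile_bounds[of "reflect c v x"] by auto
  with out show ?thesis unfolding unit_profile_def by simp
qed

end

lemma rearrange_polarize:
  assumes "unit_profile c R g"
  shows "rearrange c (polarize c v g) = rearrange c g"
  using emeasure_polarize_superlevel[OF profile_measurable[OF assms], of _ c v]
  by (simp add: rearrange_def superlevel_measure_def measure_def fun_eq_iff)

section \<open>The gain of a polarization\<close>

definition excess :: "'a::euclidean_space \<Rightarrow> ('a \<Rightarrow> real) \<Rightarrow> ennreal" where
  "excess c g = (\<integral>\<^sup>+x. ennreal (g x - rearrange c g x) \<partial>lborel)"

text \<open>
  The length of the interval of levels \<open>t\<close> for which \<open>x\<close> is in the level set of \<open>g*\<close> but not of \<open>g\<close>,
  while \<open>y\<close> is in that of \<open>g\<close> but not of \<open>g*\<close>: for these levels an exchange of the values at \<open>x\<close>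
  and \<open>y\<close> corrects both points.
\<close>
definition swap_gain :: "'a::euclidean_space \<Rightarrow> ('a \<Rightarrow> real) \<Rightarrow> 'a \<Rightarrow> 'a \<Rightarrow> ennreal" where
  "swap_gain c g x y = ennreal (min (g y) (rearrange c g x) - max (g x) (rearrange c g y))"

lemma swap_gain_inequality:
  fixes a b s t :: real
  assumes "t \<le> s"
  shows "ennreal (max a b - s) + ennreal (min a b - t) +
    (ennreal (min b s - max a t) + ennreal (min a t - max b s)) \<le> ennreal (a - s) + ennreal (b - t)"
proof -
  have pos: "ennreal x = ennreal (max 0 x)" for x by (simp add: max_def ennreal_neg)
  have "max 0 (max a b - s) + max 0 (min a b - t) + (max 0 (min b s - max a t) + max 0 (min a t - max b s))
     \<le> max 0 (a - s) + max 0 (b - t)"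
    using assms by (auto simp: max_def min_def)
  then show ?thesis
    unfolding pos[of "max a b - s"] pos[of "min a b - t"] pos[of "min b s - max a t"]
      pos[of "min a t - max b s"] pos[of "a - s"] pos[of "b - t"]
    by (simp add: ennreal_plus[symmetric] ennreal_leI del: ennreal_plus)
qed

text \<open>
  On a pair of mirror points only the exchange of values matters. Since \<open>g*\<close> is larger at the
  point on the side of \<open>c\<close>, placing the larger value of \<open>g\<close> there loses nothing and gains the
  amount of the swap.
\<close>
lemma excess_polarize:
  assumes g: "unit_profile c R g"
  shows "excess c (polarize c v g) + (\<integral>\<^sup>+x. swap_gain c g x (reflect c v x) \<partial>lborel) \<le> excess c g"
proof -
  note [measurable] = profile_measurable[OF g] rearrange_measurable[OF g]
  let ?r = "reflect c v" and ?h = "rearrange c g"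
  define H where "H w x = ennreal (w x - ?h x)" for w and x :: 'a
  define G where "G x = swap_gain c g x (?r x)" for x
  have [measurable]: "H w \<in> borel_measurable borel" if [measurable]: "w \<in> borel_measurable borel" for w
    unfolding H_def by measurable
  have [measurable]: "G \<in> borel_measurable borel" unfolding G_def swap_gain_def by measurable
  have key: "H (polarize c v g) x + H (polarize c v g) (?r x) + (G x + G (?r x)) \<le> H g x + H g (?r x)"
    if x: "hyperplane_offset c v x \<le> 0" for x
    unfolding H_def G_def swap_gain_def polarize_inside[OF x] reflect_reflect
    by (rule swap_gain_inequality) (rule rearrange_antimono[OF g dist_center_le_dist_reflect[OF x]])
  have all: "(H (polarize c v g) x + G x) + (H (polarize c v g) (?r x) + G (?r x)) \<le> H g x + H g (?r x)" for x
    using hyperplane_offset_le0_cases[of c v x] key[of x] key[of "?r x"] by (auto simp: ac_simps)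
  have "(\<integral>\<^sup>+x. H (polarize c v g) x + G x \<partial>lborel) \<le> (\<integral>\<^sup>+x. H g x \<partial>lborel)"
    by (rule nn_integral_reflect_pair_mono[of _ _ c v]) (use all in auto)
  then have "(\<integral>\<^sup>+x. H (polarize c v g) x \<partial>lborel) + (\<integral>\<^sup>+x. G x \<partial>lborel) \<le> (\<integral>\<^sup>+x. H g x \<partial>lborel)"
    by (subst (asm) nn_integral_add) auto
  then show ?thesis unfolding excess_def rearrange_polarize[OF g] H_def G_def .
qed

definition too_high :: "'a::euclidean_space \<Rightarrow> ('a \<Rightarrow> real) \<Rightarrow> real \<Rightarrow> 'a set" where
  "too_high c g t = {y. rearrange c g y \<le> t \<and> t < g y}"

definition too_low :: "'a::euclidean_space \<Rightarrow> ('a \<Rightarrow> real) \<Rightarrow> real \<Rightarrow> 'a set" where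
  "too_low c g t = {x. g x \<le> t \<and> t < rearrange c g x}"

lemma ennreal_diff_eq_nn_integral_indicator:
  "ennreal (b - a) = (\<integral>\<^sup>+t. indicator {a..<b} t \<partial>lborel)" for a b :: real
  by (cases "a \<le> b") (auto simp: ennreal_neg)

context
  fixes c :: "'a::euclidean_space" and R :: real and g :: "'a \<Rightarrow> real"
  assumes g: "unit_profile c R g" and R: "R > 0"
begin

lemmas [measurable] = profile_measurable[OF g] rearrange_measurable[OF g]

lemma too_high_borel [measurable]: "too_high c g t \<in> sets borel"
  unfolding too_high_def by measurable

lemma too_low_borel [measurable]: "too_low c g t \<in> sets borel"
  unfolding too_low_def by measurable

lemma too_high_low_pred [measurable]:
  "Measurable.pred (borel \<Otimes>\<^sub>M borel) (\<lambda>(t, x). x \<in> too_high c g t)"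
  "Measurable.pred (borel \<Otimes>\<^sub>M borel) (\<lambda>(t, x). x \<in> too_low c g t)"
  unfolding too_high_def too_low_def mem_Collect_eq by measurable

lemma too_high_subset: "0 \<le> t \<Longrightarrow> too_high c g t \<subseteq> ball c R"
  using profile_superlevel_subset[OF g, of t] by (auto simp: too_high_def)

lemma too_low_subset: "0 \<le> t \<Longrightarrow> too_low c g t \<subseteq> ball c R"
proof
  fix x assume "0 \<le> t" "x \<in> too_low c g t"
  then have "rearrange c g x \<noteq> 0" by (auto simp: too_low_def)
  then show "x \<in> ball c R" using rearrange_outside[OF g, of x] R by force
qed

lemma too_high_empty: "t \<notin> {0..1} \<Longrightarrow> too_high c g t = {}"
  using profile_bounds[OF g] rearrange_nonneg[OF g] unfolding too_high_def
  by (smt (verit) Collect_empty_eq atLeastAtMost_iff)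

lemma too_low_empty: "t \<notin> {0..1} \<Longrightarrow> too_low c g t = {}"
  using profile_bounds[OF g] rearrange_le_1[OF g] unfolding too_low_def
  by (smt (verit) Collect_empty_eq atLeastAtMost_iff)

text \<open>
  Level sets of \<open>g\<close> and \<open>g*\<close> have the same finite volume, hence so have their differences.
\<close>
lemma emeasure_too_low:
  "emeasure lborel (too_low c g t) = emeasure lborel (too_high c g t)"
proof (cases "t \<in> {0..1}")
  case True
  then have t: "0 \<le> t" by simp
  let ?A = "{x. t < g x}" and ?B = "{x. t < rearrange c g x}"
  have fin: "emeasure lborel (?A \<inter> ?B) \<noteq> \<infinity>"
  proof -
    have "emeasure lborel (?A \<inter> ?B) \<le> emeasure lborel ?A" by (intro emeasure_mono) auto
    then show ?thesis using emeasure_profile_superlevel[OF g t] by (metis ennreal_neq_top infinity_ennreal_def top_unique)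
  qed
  have "emeasure lborel (too_low c g t) + emeasure lborel (?A \<inter> ?B) = emeasure lborel (too_low c g t \<union> (?A \<inter> ?B))"
    by (rule plus_emeasure) (auto simp: too_low_def)
  also have "\<dots> = emeasure lborel ?B" by (rule arg_cong[where f = "emeasure lborel"]) (auto simp: too_low_def)
  also have "\<dots> = emeasure lborel ?A" by (rule emeasure_rearrange_superlevel[OF g t])
  also have "\<dots> = emeasure lborel (too_high c g t \<union> (?A \<inter> ?B))"
    by (rule arg_cong[where f = "emeasure lborel"]) (auto simp: too_high_def)
  also have "\<dots> = emeasure lborel (too_high c g t) + emeasure lborel (?A \<inter> ?B)"
    by (rule plus_emeasure[symmetric]) (auto simp: too_high_def)
  finally have "emeasure lborel (?A \<inter> ?B) + emeasure lborel (too_low c g t) =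
      emeasure lborel (?A \<inter> ?B) + emeasure lborel (too_high c g t)"
    by (simp only: add.commute)
  then show ?thesis using fin unfolding ennreal_add_left_cancel by blast
qed (simp add: too_high_empty too_low_empty)

lemma excess_layers: "excess c g = (\<integral>\<^sup>+t. emeasure lborel (too_high c g t) \<partial>lborel)"
proof -
  have "excess c g = (\<integral>\<^sup>+x. (\<integral>\<^sup>+t. indicator (too_high c g t) x \<partial>lborel) \<partial>lborel)"
    unfolding excess_def ennreal_diff_eq_nn_integral_indicator
    by (intro nn_integral_cong) (auto simp: too_high_def indicator_def)
  also have "\<dots> = (\<integral>\<^sup>+t. (\<integral>\<^sup>+x. indicator (too_high c g t) x \<partial>lborel) \<partial>lborel)"
    by (rule lborel_pair.Fubini') measurable
  finally show ?thesis by simp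
qed

lemma swap_gain_layers:
  "swap_gain c g x y = (\<integral>\<^sup>+t. indicator (too_low c g t) x * indicator (too_high c g t) y \<partial>lborel)"
  unfolding swap_gain_def ennreal_diff_eq_nn_integral_indicator
  by (intro nn_integral_cong) (auto simp: too_high_def too_low_def indicator_def)

text \<open>
  Cauchy-Schwarz over the levels, which fill an interval of length \<open>1\<close>.
\<close>
lemma excess_square_le:
  assumes e: "excess c g = ennreal e" "0 \<le> e"
  shows "ennreal (e\<^sup>2) \<le> (\<integral>\<^sup>+t. (emeasure lborel (too_high c g t))\<^sup>2 \<partial>lborel)"
proof -
  define f where "f t = emeasure lborel (too_high c g t)" for t
  have [measurable]: "f \<in> borel_measurable borel" unfolding f_def by measurable
  have "(\<integral>\<^sup>+t. f t \<partial>lborel) = (\<integral>\<^sup>+t. f t * indicator {0..1} t \<partial>lborel)"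
    by (intro nn_integral_cong) (auto simp: f_def indicator_def too_high_empty)
  then have "(ennreal e)\<^sup>2 = (\<integral>\<^sup>+t. f t * indicator {0..1} t \<partial>lborel)\<^sup>2"
    using e excess_layers by (simp add: f_def)
  also have "\<dots> \<le> (\<integral>\<^sup>+t. (f t)\<^sup>2 \<partial>lborel) * (\<integral>\<^sup>+t. (indicator {0..1} t)\<^sup>2 \<partial>(lborel :: real measure))"
    by (rule Cauchy_Schwarz_nn_integral) auto
  also have "(\<lambda>t. (indicator {0..1} t)\<^sup>2) = (indicator {0..1} :: real \<Rightarrow> ennreal)"
    by (auto simp: fun_eq_iff indicator_def)
  also have "(\<integral>\<^sup>+t. indicator {0..1} t \<partial>(lborel :: real measure)) = 1" by simp
  finally show ?thesis using e by (simp add: f_def ennreal_power)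
qed

text \<open>
  A point \<open>x\<close> that is too low lies inside the ball \<open>{g* > t}\<close> and a point \<open>y\<close> that is too high lies
  outside, so \<open>y\<close> is further from \<open>c\<close> than \<open>x\<close>. Only the \<open>y\<close> in a thin shell fail to
  be further away by \<open>d\<close>.
\<close>
lemma emeasure_shell_le:
  assumes sh: "\<And>s. 0 \<le> s \<Longrightarrow> s \<le> R \<Longrightarrow> unit_ball_vol DIM('a) * ((s + d) ^ DIM('a) - s ^ DIM('a)) \<le> e"
    and d: "d > 0" and e: "e \<ge> 0" and x: "x \<in> too_low c g t" and t: "0 \<le> t"
  shows "emeasure lborel (too_high c g t) \<le>
    emeasure lborel (too_high c g t \<inter> {y. dist c x + d \<le> dist c y}) + ennreal e"
proof -
  define s where "s = dist c x"
  have s: "0 \<le> s" "s \<le> R" using x too_low_subset[OF t] by (auto simp: s_def)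
  have out: "s \<le> dist c y" if "y \<in> too_high c g t" for y
  proof (rule ccontr)
    assume "\<not> s \<le> dist c y"
    then have "rearrange c g x \<le> rearrange c g y" by (intro rearrange_antimono[OF g]) (simp add: s_def)
    then show False using that x by (simp add: too_high_def too_low_def)
  qed
  have "emeasure lborel (ball c (s + d) - ball c s) = emeasure lborel (ball c (s + d)) - emeasure lborel (ball c s)"
    using s d emeasure_lborel_ball_finite[of c s] by (intro emeasure_Diff) auto
  also have "\<dots> = ennreal (unit_ball_vol DIM('a) * ((s + d) ^ DIM('a) - s ^ DIM('a)))"
    using s d by (simp add: emeasure_ball ennreal_minus right_diff_distrib)
  also have "\<dots> \<le> ennreal e" by (intro ennreal_leI sh s)
  finally have shell: "emeasure lborel (ball c (s + d) - ball c s) \<le> ennreal e" .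
  have "too_high c g t \<subseteq> (too_high c g t \<inter> {y. s + d \<le> dist c y}) \<union> (ball c (s + d) - ball c s)"
    using out by force
  then have "emeasure lborel (too_high c g t) \<le> emeasure lborel ((too_high c g t \<inter> {y. s + d \<le> dist c y}) \<union> (ball c (s + d) - ball c s))"
    by (intro emeasure_mono) measurable
  also have "\<dots> \<le> emeasure lborel (too_high c g t \<inter> {y. s + d \<le> dist c y}) + emeasure lborel (ball c (s + d) - ball c s)"
    by (intro emeasure_subadditive) measurable
  also have "\<dots> \<le> emeasure lborel (too_high c g t \<inter> {y. s + d \<le> dist c y}) + ennreal e"
    using shell by (intro add_left_mono)
  finally show ?thesis by (simp add: s_def)
qed

text \<open>
  For each level \<open>t\<close> and each \<open>x\<close> that is too low, the normals whose reflection sends \<open>x\<close> to a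
  point that is too high have measure at least \<open>(p - e) / L\<close>, where \<open>p\<close> is the measure of both
  discrepancy sets. Integrating over such \<open>x\<close> bounds \<open>p\<^sup>2 - e p\<close> by \<open>L\<close> times the measure of the pairs
  of a point and a normal with this property; integrating over \<open>t\<close> turns this measure into the
  total gain over all normals in \<open>V\<close>.
\<close>
lemma averaged_gain:
  assumes sh: "\<And>s. 0 \<le> s \<Longrightarrow> s \<le> R \<Longrightarrow> unit_ball_vol DIM('a) * ((s + d) ^ DIM('a) - s ^ DIM('a)) \<le> e"
    and d: "d > 0" and e: "e \<ge> 0"
  defines "V \<equiv> {v::'a. d / 2 \<le> norm v \<and> norm v \<le> R}"
    and "L \<equiv> ennreal ((16 * R / d + 2) ^ DIM('a))"
  shows "(\<integral>\<^sup>+t. (emeasure lborel (too_high c g t))\<^sup>2 \<partial>lborel) \<le>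
    L * (\<integral>\<^sup>+v. indicator V v * (\<integral>\<^sup>+x. swap_gain c g x (reflect c v x) \<partial>lborel) \<partial>lborel) + ennreal e * excess c g"
proof -
  have [measurable]: "V \<in> sets borel" unfolding V_def by measurable
  define W where "W t x = (\<integral>\<^sup>+v. indicator V v * indicator (too_high c g t) (reflect c v x) \<partial>lborel)" for t x
  have [measurable]: "(\<lambda>(t, x). W t x) \<in> borel_measurable (borel \<Otimes>\<^sub>M borel)"
    unfolding W_def by measurable
  have hit: "emeasure lborel (too_high c g t) \<le> L * W t x + ennreal e" if x: "x \<in> too_low c g t" for t x
  proof -
    have t: "0 \<le> t" using x too_low_empty[of t] by (cases "t \<in> {0..1}") auto
    have xR: "dist c x \<le> R" using x too_low_subset[OF t] by auto
    have "W t x = (\<integral>\<^sup>+v. indicator {v. d / 2 \<le> norm v \<and> norm v \<le> R \<and> reflect c v x \<in> too_high c g t} v \<partial>lborel)"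
      unfolding W_def V_def by (intro nn_integral_cong) (auto simp: indicator_def)
    also have "\<dots> = emeasure lborel {v. d / 2 \<le> norm v \<and> norm v \<le> R \<and> reflect c v x \<in> too_high c g t}"
      by (rule nn_integral_indicator) measurable
    finally have W: "W t x = emeasure lborel {v. d / 2 \<le> norm v \<and> norm v \<le> R \<and> reflect c v x \<in> too_high c g t}" .
    have "emeasure lborel (too_high c g t \<inter> {y. dist c x + d \<le> dist c y}) \<le> L * W t x"
      unfolding W L_def by (rule emeasure_le_emeasure_reflecting_normals[OF d R xR _ too_high_subset[OF t]]) measurable
    then show ?thesis
      using emeasure_shell_le[OF sh d e x t] by (meson add_right_mono order_trans)
  qed
  have "(emeasure lborel (too_high c g t))\<^sup>2 \<le>
      L * (\<integral>\<^sup>+x. indicator (too_low c g t) x * W t x \<partial>lborel) + ennreal e * emeasure lborel (too_high c g t)" for t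
  proof -
    have "(emeasure lborel (too_high c g t))\<^sup>2 = (\<integral>\<^sup>+x. emeasure lborel (too_high c g t) * indicator (too_low c g t) x \<partial>lborel)"
      by (simp add: nn_integral_cmult emeasure_too_low power2_eq_square)
    also have "\<dots> \<le> (\<integral>\<^sup>+x. L * (indicator (too_low c g t) x * W t x) + ennreal e * indicator (too_low c g t) x \<partial>lborel)"
      using hit by (intro nn_integral_mono) (auto simp: indicator_def)
    also have "\<dots> = L * (\<integral>\<^sup>+x. indicator (too_low c g t) x * W t x \<partial>lborel) + ennreal e * emeasure lborel (too_high c g t)"
      by (subst nn_integral_add) (auto simp: nn_integral_cmult emeasure_too_low)
    finally show ?thesis .
  qed
  then have "(\<integral>\<^sup>+t. (emeasure lborel (too_high c g t))\<^sup>2 \<partial>lborel) \<le>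
      (\<integral>\<^sup>+t. L * (\<integral>\<^sup>+x. indicator (too_low c g t) x * W t x \<partial>lborel) + ennreal e * emeasure lborel (too_high c g t) \<partial>lborel)"
    by (intro nn_integral_mono)
  also have "\<dots> = L * (\<integral>\<^sup>+t. (\<integral>\<^sup>+x. indicator (too_low c g t) x * W t x \<partial>lborel) \<partial>lborel) + ennreal e * excess c g"
    by (subst nn_integral_add) (auto simp: nn_integral_cmult excess_layers)
  also have "(\<integral>\<^sup>+t. (\<integral>\<^sup>+x. indicator (too_low c g t) x * W t x \<partial>lborel) \<partial>lborel) =
     (\<integral>\<^sup>+x. (\<integral>\<^sup>+t. indicator (too_low c g t) x * W t x \<partial>lborel) \<partial>lborel)"
    by (rule lborel_pair.Fubini'[symmetric]) measurable
  also have "\<dots> = (\<integral>\<^sup>+x. (\<integral>\<^sup>+v. indicator V v * swap_gain c g x (reflect c v x) \<partial>lborel) \<partial>lborel)"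
  proof (rule nn_integral_cong)
    fix x
    have "(\<integral>\<^sup>+t. indicator (too_low c g t) x * W t x \<partial>lborel) =
      (\<integral>\<^sup>+t. (\<integral>\<^sup>+v. indicator V v * (indicator (too_low c g t) x * indicator (too_high c g t) (reflect c v x)) \<partial>lborel) \<partial>lborel)"
      unfolding W_def by (intro nn_integral_cong, subst nn_integral_cmult[symmetric]) (auto simp: ac_simps)
    also have "\<dots> = (\<integral>\<^sup>+v. (\<integral>\<^sup>+t. indicator V v * (indicator (too_low c g t) x * indicator (too_high c g t) (reflect c v x)) \<partial>lborel) \<partial>lborel)"
      by (rule lborel_pair.Fubini') measurable
    also have "\<dots> = (\<integral>\<^sup>+v. indicator V v * swap_gain c g x (reflect c v x) \<partial>lborel)"
      unfolding swap_gain_layers by (intro nn_integral_cong nn_integral_cmult) measurable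
    finally show "(\<integral>\<^sup>+t. indicator (too_low c g t) x * W t x \<partial>lborel) = (\<integral>\<^sup>+v. indicator V v * swap_gain c g x (reflect c v x) \<partial>lborel)" .
  qed
  also have "\<dots> = (\<integral>\<^sup>+v. (\<integral>\<^sup>+x. indicator V v * swap_gain c g x (reflect c v x) \<partial>lborel) \<partial>lborel)"
    unfolding swap_gain_def by (rule lborel_pair.Fubini') measurable
  also have "\<dots> = (\<integral>\<^sup>+v. indicator V v * (\<integral>\<^sup>+x. swap_gain c g x (reflect c v x) \<partial>lborel) \<partial>lborel)"
    unfolding swap_gain_def by (intro nn_integral_cong nn_integral_cmult) measurable
  finally show ?thesis .
qed

end

section \<open>Approximating the rearrangement by polarizations\<close>

lemma uniformly_thin_shells:
  assumes e: "e > 0"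
  shows "\<exists>d>0. \<forall>s. 0 \<le> s \<and> s \<le> R \<longrightarrow> w * ((s + d) ^ n - s ^ n) \<le> (e::real)"
proof -
  have "uniformly_continuous_on {0..R+1} (\<lambda>s. w * s ^ n)"
    by (intro compact_uniformly_continuous continuous_intros compact_Icc)
  then obtain d where d: "d > 0" "\<And>s t. s \<in> {0..R+1} \<Longrightarrow> t \<in> {0..R+1} \<Longrightarrow> dist t s < d \<Longrightarrow> dist (w * t ^ n) (w * s ^ n) < e"
    unfolding uniformly_continuous_on_def using e by blast
  define d' where "d' = min (d / 2) 1"
  have d': "d' > 0" "d' < d" "d' \<le> 1" using d(1) by (auto simp: d'_def)
  have "w * ((s + d') ^ n - s ^ n) \<le> e" if "0 \<le> s" "s \<le> R" for s
  proof -
    have "dist (w * (s + d') ^ n) (w * s ^ n) < e" using that d' by (intro d(2)) (auto simp: dist_real_def)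
    then show ?thesis by (simp add: dist_real_def right_diff_distrib)
  qed
  with d'(1) show ?thesis by blast
qed

lemma excess_finite:
  assumes g: "unit_profile c R g"
  shows "excess c g < top"
proof -
  have "excess c g \<le> (\<integral>\<^sup>+x. indicator (ball c R) x \<partial>lborel)"
    unfolding excess_def
  proof (intro nn_integral_mono)
    fix x show "ennreal (g x - rearrange c g x) \<le> indicator (ball c R) x"
      using profile_bounds[OF g, of x] profile_outside[OF g, of x] rearrange_nonneg[OF g, of x]
      by (cases "x \<in> ball c R") (auto simp: ennreal_neg intro!: ennreal_leI[of _ 1, simplified])
  qed
  then show ?thesis using emeasure_lborel_ball_finite[of c R] by (simp add: le_less_trans)
qed

text \<open>
  The decrement depends on \<open>\<eta>\<close>, \<open>R\<close> and the dimension only. With shells thin enough that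
  \<open>e = \<eta> / 2\<close>, the averaged gain is at least a multiple of \<open>E\<^sup>2 - e E \<ge> \<eta>\<^sup>2 / 2\<close>, where \<open>E\<close> is the
  excess, and some reflection does at least as well as the average.
\<close>
lemma ex_polarize_decrease:
  fixes c :: "'a::euclidean_space"
  assumes R: "R > 0" and eta: "\<eta> > 0"
  shows "\<exists>\<kappa>>0. \<forall>g. unit_profile c R g \<longrightarrow> ennreal \<eta> \<le> excess c g \<longrightarrow>
    (\<exists>v. excess c (polarize c v g) + ennreal \<kappa> \<le> excess c g)"
proof -
  obtain d where d: "d > 0" and sh: "\<And>s. 0 \<le> s \<Longrightarrow> s \<le> R \<Longrightarrow>
      unit_ball_vol DIM('a) * ((s + d) ^ DIM('a) - s ^ DIM('a)) \<le> \<eta> / 2"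
    using uniformly_thin_shells[of "\<eta> / 2" R "unit_ball_vol DIM('a)" "DIM('a)"] eta by auto
  define V where "V = {v::'a. d / 2 \<le> norm v \<and> norm v \<le> R}"
  define L where "L = (16 * R / d + 2) ^ DIM('a)"
  define M where "M = measure lborel (cball (0::'a) R)"
  have L: "L > 0" using d R by (simp add: L_def add_pos_pos)
  have M: "M > 0" using R by (simp add: M_def content_cball)
  have [measurable]: "V \<in> sets borel" unfolding V_def by measurable
  have "emeasure lborel V \<le> emeasure lborel (cball (0::'a) R)"
    by (intro emeasure_mono) (auto simp: V_def)
  also have "\<dots> = ennreal M" unfolding M_def using emeasure_lborel_cball_finite[of "0::'a" R]
    by (intro emeasure_eq_ennreal_measure) auto
  finally have VM: "emeasure lborel V \<le> ennreal M" .
  \<comment> \<open>Half of the lower bound \<open>\<eta>\<^sup>2 / (2 L M)\<close> for the average gain.\<close>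
  define \<kappa> where "\<kappa> = \<eta>\<^sup>2 / (4 * L * M)"
  have k: "\<kappa> > 0" using eta L M by (simp add: \<kappa>_def)
  have "\<exists>v. excess c (polarize c v g) + ennreal \<kappa> \<le> excess c g"
    if g: "unit_profile c R g" and big: "ennreal \<eta> \<le> excess c g" for g
  proof (rule ccontr)
    assume neg: "\<not> ?thesis"
    obtain e where e: "excess c g = ennreal e" "0 \<le> e"
      using excess_finite[OF g] by (cases "excess c g") auto
    have ee: "\<eta> \<le> e" using big e by simp
    define G where "G v = (\<integral>\<^sup>+x. swap_gain c g x (reflect c v x) \<partial>lborel)" for v
    have small: "G v \<le> ennreal \<kappa>" for v
    proof (rule ccontr)
      assume "\<not> G v \<le> ennreal \<kappa>"
      then have "excess c (polarize c v g) + ennreal \<kappa> \<le> excess c (polarize c v g) + G v"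
        by (intro add_left_mono) simp
      also have "\<dots> \<le> excess c g" unfolding G_def by (rule excess_polarize[OF g])
      finally show False using neg by blast
    qed
    have "(\<integral>\<^sup>+v. indicator V v * G v \<partial>lborel) \<le> (\<integral>\<^sup>+v. ennreal \<kappa> * indicator V v \<partial>lborel)"
      using small by (intro nn_integral_mono) (auto simp: indicator_def)
    also have "\<dots> = ennreal \<kappa> * emeasure lborel V" by (simp add: nn_integral_cmult)
    also have "\<dots> \<le> ennreal \<kappa> * ennreal M" by (intro mult_left_mono VM) simp
    finally have GM: "(\<integral>\<^sup>+v. indicator V v * G v \<partial>lborel) \<le> ennreal (\<kappa> * M)"
      using k M by (simp add: ennreal_mult)
    have "ennreal (e\<^sup>2) \<le> (\<integral>\<^sup>+t. (emeasure lborel (too_high c g t))\<^sup>2 \<partial>lborel)"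
      by (rule excess_square_le[OF g R e])
    also have "\<dots> \<le> ennreal L * (\<integral>\<^sup>+v. indicator V v * G v \<partial>lborel) + ennreal (\<eta> / 2) * excess c g"
      unfolding L_def V_def G_def using averaged_gain[OF g R sh d] eta by simp
    also have "\<dots> \<le> ennreal L * ennreal (\<kappa> * M) + ennreal (\<eta> / 2) * ennreal e"
      unfolding e(1) by (intro add_right_mono mult_left_mono GM) simp
    also have "\<dots> = ennreal (L * (\<kappa> * M) + \<eta> / 2 * e)"
      using L k M eta e by (simp add: ennreal_mult[symmetric] ennreal_plus[symmetric] del: ennreal_plus)
    finally have "e\<^sup>2 \<le> L * (\<kappa> * M) + \<eta> / 2 * e"
      using L k M eta e by (subst (asm) ennreal_le_iff) auto
    also have "L * (\<kappa> * M) = \<eta>\<^sup>2 / 4" using L M by (simp add: \<kappa>_def field_simps)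
    finally have "e\<^sup>2 \<le> \<eta>\<^sup>2 / 4 + \<eta> / 2 * e" .
    moreover have "\<eta>\<^sup>2 \<le> \<eta> * e" "\<eta> * e \<le> e\<^sup>2" using ee eta by (simp_all add: power2_eq_square mult_right_mono)
    ultimately have "\<eta> * e \<le> 0" using eta by (simp add: field_simps)
    then show False using ee eta by (simp add: mult_le_0_iff)
  qed
  with k show ?thesis by blast
qed

inductive_set polarizations :: "'a::euclidean_space \<Rightarrow> ('a \<Rightarrow> real) \<Rightarrow> ('a \<Rightarrow> real) set" for c g where
  base: "g \<in> polarizations c g"
| step: "h \<in> polarizations c g \<Longrightarrow> polarize c v h \<in> polarizations c g"

lemma polarizations_profile:
  assumes "h \<in> polarizations c g" "unit_profile c R g"
  shows "unit_profile c R h" "rearrange c h = rearrange c g"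
proof -
  have "unit_profile c R h \<and> rearrange c h = rearrange c g"
    using assms by (induction) (auto intro: unit_profile_polarize simp: rearrange_polarize)
  then show "unit_profile c R h" "rearrange c h = rearrange c g" by auto
qed

text \<open>
  Otherwise the excess could be lowered by the same amount any number of times.
\<close>
lemma polarizations_excess_small:
  assumes g: "unit_profile c R g" and R: "R > 0" and eta: "\<eta> > 0"
  shows "\<exists>h\<in>polarizations c g. excess c h < ennreal \<eta>"
proof (rule ccontr)
  assume "\<not> ?thesis"
  then have big: "\<And>h. h \<in> polarizations c g \<Longrightarrow> ennreal \<eta> \<le> excess c h" by (auto simp: not_less)
  obtain \<kappa> where k: "\<kappa> > 0" and dec: "\<And>h. unit_profile c R h \<Longrightarrow> ennreal \<eta> \<le> excess c h \<Longrightarrow>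
      (\<exists>v. excess c (polarize c v h) + ennreal \<kappa> \<le> excess c h)"
    using ex_polarize_decrease[OF R eta] by metis
  have ex: "\<exists>h\<in>polarizations c g. excess c h + ennreal (real n * \<kappa>) \<le> excess c g" for n
  proof (induction n)
    case 0
    show ?case by (auto intro!: bexI[of _ g] polarizations.base)
  next
    case (Suc n)
    then obtain h where h: "h \<in> polarizations c g" "excess c h + ennreal (real n * \<kappa>) \<le> excess c g" by blast
    obtain v where v: "excess c (polarize c v h) + ennreal \<kappa> \<le> excess c h"
      using dec[OF polarizations_profile(1)[OF h(1) g] big[OF h(1)]] by blast
    have "excess c (polarize c v h) + ennreal (real (Suc n) * \<kappa>) = excess c (polarize c v h) + ennreal \<kappa> + ennreal (real n * \<kappa>)"
      using k by (simp add: distrib_right add.assoc)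
    also have "\<dots> \<le> excess c h + ennreal (real n * \<kappa>)" using v by (rule add_right_mono)
    also note h(2)
    finally show ?case using polarizations.step[OF h(1)] by blast
  qed
  obtain e where e: "excess c g = ennreal e" "0 \<le> e"
    using excess_finite[OF g] by (cases "excess c g") auto
  obtain n where n: "e < real n * \<kappa>" using reals_Archimedean3[OF k] by blast
  obtain h where h: "excess c h + ennreal (real n * \<kappa>) \<le> ennreal e" using ex[of n] e(1) by auto
  have "ennreal (real n * \<kappa>) \<le> excess c h + ennreal (real n * \<kappa>)" by (simp add: add_increasing)
  also note h
  finally have "ennreal (real n * \<kappa>) \<le> ennreal e" .
  then show False using n e(2) by (simp add: ennreal_le_iff)
qed

text \<open>
  The parts of \<open>g\<close> above and below \<open>g*\<close> have the same integral, since the discrepancy sets have the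
  same volume at every level. Hence a small excess means closeness in \<open>L\<^sup>1\<close>.
\<close>
lemma nn_integral_abs_diff_rearrange:
  assumes g: "unit_profile c R g" and R: "0 < R"
  shows "(\<integral>\<^sup>+x. ennreal \<bar>g x - rearrange c g x\<bar> \<partial>lborel) = 2 * excess c g"
proof -
  note [measurable] = profile_measurable[OF g] rearrange_measurable[OF g]
    too_high_borel[OF g R] too_low_borel[OF g R] too_high_low_pred[OF g R]
  have low: "(\<integral>\<^sup>+x. ennreal (rearrange c g x - g x) \<partial>lborel) = excess c g"
  proof -
    have "(\<integral>\<^sup>+x. ennreal (rearrange c g x - g x) \<partial>lborel) = (\<integral>\<^sup>+x. (\<integral>\<^sup>+t. indicator (too_low c g t) x \<partial>lborel) \<partial>lborel)"
      unfolding ennreal_diff_eq_nn_integral_indicator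
      by (intro nn_integral_cong) (auto simp: too_low_def indicator_def)
    also have "\<dots> = (\<integral>\<^sup>+t. (\<integral>\<^sup>+x. indicator (too_low c g t) x \<partial>lborel) \<partial>lborel)"
      by (rule lborel_pair.Fubini') measurable
    finally show ?thesis by (simp add: emeasure_too_low[OF g R] excess_layers[OF g R])
  qed
  have "(\<integral>\<^sup>+x. ennreal \<bar>g x - rearrange c g x\<bar> \<partial>lborel)
     = (\<integral>\<^sup>+x. ennreal (g x - rearrange c g x) + ennreal (rearrange c g x - g x) \<partial>lborel)"
    by (intro nn_integral_cong) (auto simp: abs_if ennreal_neg)
  also have "\<dots> = 2 * excess c g"
    by (subst nn_integral_add) (auto simp: low excess_def[symmetric] mult_2)
  finally show ?thesis .
qed

lemma polarizations_converge_AE: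
  assumes g: "unit_profile c R g" and R: "R > 0"
  shows "\<exists>h. (\<forall>n. h n \<in> polarizations c g) \<and> (AE x in lborel. (\<lambda>n. h n x) \<longlonglongrightarrow> rearrange c g x)"
proof -
  have "\<exists>h\<in>polarizations c g. excess c h < ennreal (1 / real (Suc n))" for n
    using polarizations_excess_small[OF g R] by simp
  then obtain h where h: "\<And>n. h n \<in> polarizations c g" "\<And>n. excess c (h n) < ennreal (1 / real (Suc n))" by metis
  note hp = polarizations_profile[OF h(1) g]
  note [measurable] = profile_measurable[OF hp(1)] rearrange_measurable[OF g]
  define u where "u n x = h n x - rearrange c g x" for n x
  have bound: "(\<integral>\<^sup>+x. ennreal (norm (u n x)) \<partial>lborel) \<le> ennreal (2 * (1 / real (Suc n)))" for n
  proof -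
    have "(\<integral>\<^sup>+x. ennreal (norm (u n x)) \<partial>lborel) = 2 * excess c (h n)"
      using nn_integral_abs_diff_rearrange[OF hp(1)[of n] R] by (simp add: u_def hp(2))
    also have "\<dots> \<le> 2 * ennreal (1 / real (Suc n))" using h(2)[of n] by (intro mult_left_mono) auto
    also have "\<dots> = ennreal (2 * (1 / real (Suc n)))" by (subst ennreal_mult) auto
    finally show ?thesis .
  qed
  have int: "integrable lborel (u n)" for n
  proof (rule integrableI_bounded)
    show "u n \<in> borel_measurable lborel" unfolding u_def by measurable
    show "(\<integral>\<^sup>+x. ennreal (norm (u n x)) \<partial>lborel) < \<infinity>"
      using bound[of n] by (simp add: le_less_trans)
  qed
  have "(\<lambda>n. \<integral>x. norm (u n x) \<partial>lborel) \<longlonglongrightarrow> 0"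
  proof (rule tendsto_sandwich[OF _ _ tendsto_const])
    show "\<forall>\<^sub>F n in sequentially. 0 \<le> (\<integral>x. norm (u n x) \<partial>lborel)" by (simp add: integral_nonneg)
    have "(\<integral>x. norm (u n x) \<partial>lborel) \<le> 2 * (1 / real (Suc n))" for n
      using bound[of n] nn_integral_eq_integral[OF integrable_norm[OF int[of n]]] by (simp add: ennreal_le_iff)
    then show "\<forall>\<^sub>F n in sequentially. (\<integral>x. norm (u n x) \<partial>lborel) \<le> 2 * (1 / real (Suc n))" by simp
    show "(\<lambda>n. 2 * (1 / real (Suc n))) \<longlonglongrightarrow> 0"
      using tendsto_mult[OF tendsto_const LIMSEQ_inverse_real_of_nat, of 2] by (simp add: inverse_eq_divide)
  qed
  from tendsto_L1_AE_subseq[OF int this] obtain r where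
    r: "AE x in lborel. (\<lambda>n. u (r n) x) \<longlonglongrightarrow> 0" by blast
  have "AE x in lborel. (\<lambda>n. h (r n) x) \<longlonglongrightarrow> rearrange c g x"
    using r
  proof (eventually_elim)
    case (elim x)
    from tendsto_add[OF this tendsto_const, of "rearrange c g x"] show ?case by (simp add: u_def)
  qed
  with h(1) show ?thesis by (intro exI[of _ "\<lambda>n. h (r n)"]) auto
qed

section \<open>The rearrangement inequality\<close>

definition squash :: "real \<Rightarrow> real" where "squash s = s / (1 + s)"
definition unsquash :: "real \<Rightarrow> real" where "unsquash t = t / (1 - t)"

lemma unsquash_squash: "0 \<le> s \<Longrightarrow> unsquash (squash s) = s"
  by (simp add: squash_def unsquash_def field_simps)

lemma squash_bounds: "0 \<le> s \<Longrightarrow> 0 \<le> squash s \<and> squash s < 1"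
  by (simp add: squash_def)

lemma unsquash_mono: "0 \<le> s \<Longrightarrow> s \<le> t \<Longrightarrow> t < 1 \<Longrightarrow> unsquash s \<le> unsquash t"
  unfolding unsquash_def by (rule frac_le) auto

lemma unsquash_nonneg: "0 \<le> t \<Longrightarrow> t \<le> 1 \<Longrightarrow> 0 \<le> unsquash t"
  by (simp add: unsquash_def)

lemma less_unsquash_iff:
  assumes "0 \<le> s" "0 \<le> t" "t < 1"
  shows "s < unsquash t \<longleftrightarrow> squash s < t"
  using assms by (simp add: squash_def unsquash_def field_simps)

lemma measurable_unsquash [measurable]: "unsquash \<in> borel_measurable borel"
  unfolding unsquash_def by measurable

lemma measurable_squash [measurable]: "squash \<in> borel_measurable borel"
  unfolding squash_def by measurable

text \<open>
  The layer cake formula, with the levels written in terms of \<open>h\<close>; it shows that the \<open>L\<^sup>p\<close> norm of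
  \<open>unsquash \<circ> h\<close> depends only on the volumes of the level sets of \<open>h\<close>. The value \<open>h x = 1\<close>, where
  \<open>unsquash\<close> has the meaningless value \<open>1 / 0 = 0\<close>, is admitted on a null set.
\<close>
lemma nn_integral_unsquash_powr:
  fixes h :: "'a::euclidean_space \<Rightarrow> real"
  assumes p: "p > 0" and [measurable]: "h \<in> borel_measurable borel" and h: "\<And>x. 0 \<le> h x \<and> h x \<le> 1"
    and h1: "AE x in lborel. h x < 1"
  shows "(\<integral>\<^sup>+x. ennreal (unsquash (h x) powr p) \<partial>lborel) =
    (\<integral>\<^sup>+t. indicator {0..} t * emeasure lborel {x. squash (t powr (1 / p)) < h x} \<partial>lborel)"
proof -
  have iff: "t < unsquash y powr p \<longleftrightarrow> squash (t powr (1 / p)) < y" if "0 \<le> t" "0 \<le> y" "y < 1" for t y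
  proof -
    have "t < unsquash y powr p \<longleftrightarrow> t powr (1 / p) < unsquash y"
    proof
      assume "t < unsquash y powr p"
      then have "t powr (1 / p) < (unsquash y powr p) powr (1 / p)"
        using p that by (intro powr_less_mono2) auto
      then show "t powr (1 / p) < unsquash y"
        using p that unsquash_nonneg[of y] by (simp add: powr_powr)
    next
      assume "t powr (1 / p) < unsquash y"
      then have "(t powr (1 / p)) powr p < unsquash y powr p"
        using p that by (intro powr_less_mono2) auto
      then show "t < unsquash y powr p" using p that by (simp add: powr_powr)
    qed
    also have "\<dots> \<longleftrightarrow> squash (t powr (1 / p)) < y" using that by (intro less_unsquash_iff) auto
    finally show ?thesis .
  qed
  have "(\<integral>\<^sup>+x. ennreal (unsquash (h x) powr p) \<partial>lborel) =
    (\<integral>\<^sup>+x. (\<integral>\<^sup>+t. indicator {0..} t * indicator {x. squash (t powr (1 / p)) < h x} x \<partial>lborel) \<partial>lborel)"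
  proof (rule nn_integral_cong_AE, use h1 in eventually_elim)
    fix x assume x: "h x < 1"
    have "ennreal (unsquash (h x) powr p) = (\<integral>\<^sup>+t. indicator {0..<unsquash (h x) powr p} t \<partial>lborel)"
      by simp
    also have "\<dots> = (\<integral>\<^sup>+t. indicator {0..} t * indicator {x. squash (t powr (1 / p)) < h x} x \<partial>lborel)"
      using iff[of _ "h x"] h[of x] x by (intro nn_integral_cong) (auto simp: indicator_def)
    finally show "ennreal (unsquash (h x) powr p) =
      (\<integral>\<^sup>+t. indicator {0..} t * indicator {x. squash (t powr (1 / p)) < h x} x \<partial>lborel)" .
  qed
  also have "\<dots> = (\<integral>\<^sup>+t. (\<integral>\<^sup>+x. indicator {0..} t * indicator {x. squash (t powr (1 / p)) < h x} x \<partial>lborel) \<partial>lborel)"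
    by (rule lborel_pair.Fubini') measurable
  also have "\<dots> = (\<integral>\<^sup>+t. indicator {0..} t * emeasure lborel {x. squash (t powr (1 / p)) < h x} \<partial>lborel)"
    by (intro nn_integral_cong) (simp add: nn_integral_cmult)
  finally show ?thesis .
qed

text \<open>
  The symmetric decreasing rearrangement of a nonnegative function. The detour through the
  bounded function \<open>f / (1 + f)\<close> avoids infinite values; only at \<open>c\<close>, when \<open>f\<close> is
  unbounded, does the result depend on a default value.
\<close>
definition symmetrize :: "'a::euclidean_space \<Rightarrow> ('a \<Rightarrow> real) \<Rightarrow> 'a \<Rightarrow> real" where
  "symmetrize c f x = unsquash (rearrange c (\<lambda>y. squash (f y)) x)"

text \<open>
  Fatou's lemma in both variables. The kernel has to be finite off the diagonal for the
  integrands to converge, and the diagonal is negligible.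
\<close>
lemma interaction_le_of_AE_limit:
  fixes u :: "nat \<Rightarrow> 'a::euclidean_space \<Rightarrow> real"
  assumes p: "p > 0" and [measurable]: "\<And>n. u n \<in> borel_measurable borel" "K \<in> borel_measurable borel"
    and K: "\<And>t. t > 0 \<Longrightarrow> K t < top"
    and lim: "AE x in lborel. (\<lambda>n. u n x) \<longlonglongrightarrow> w x"
    and le: "\<And>n. interaction K p (u n) \<le> B"
  shows "interaction K p w \<le> B"
proof -
  define e where "e v x y = ennreal (\<bar>v x - v y\<bar> powr p) * K (dist x y)" for v and x y :: 'a
  have [measurable]: "(\<lambda>(x,y). e (u n) x y) \<in> borel_measurable (borel \<Otimes>\<^sub>M borel)" for n
    unfolding e_def by measurable
  have pt: "liminf (\<lambda>n. e (u n) x y) = e w x y"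
    if "(\<lambda>n. u n x) \<longlonglongrightarrow> w x" "(\<lambda>n. u n y) \<longlonglongrightarrow> w y" "y \<noteq> x" for x y
  proof (rule lim_imp_Liminf)
    have "(\<lambda>n. \<bar>u n x - u n y\<bar> powr p) \<longlonglongrightarrow> \<bar>w x - w y\<bar> powr p"
      using p that by (intro tendsto_powr2 tendsto_intros) auto
    then have "(\<lambda>n. K (dist x y) * ennreal (\<bar>u n x - u n y\<bar> powr p)) \<longlonglongrightarrow> K (dist x y) * ennreal (\<bar>w x - w y\<bar> powr p)"
      using K[of "dist x y"] that(3) by (intro ennreal_tendsto_cmult tendsto_ennrealI) auto
    then show "(\<lambda>n. e (u n) x y) \<longlonglongrightarrow> e w x y" by (simp add: e_def mult.commute)
  qed simp
  have "interaction K p w = (\<integral>\<^sup>+x. (\<integral>\<^sup>+y. e w x y \<partial>lborel) \<partial>lborel)"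
    by (simp add: interaction_def e_def)
  also have "\<dots> \<le> (\<integral>\<^sup>+x. liminf (\<lambda>n. \<integral>\<^sup>+y. e (u n) x y \<partial>lborel) \<partial>lborel)"
  proof (rule nn_integral_mono_AE, use lim in eventually_elim)
    fix x assume x: "(\<lambda>n. u n x) \<longlonglongrightarrow> w x"
    have "(\<integral>\<^sup>+y. e w x y \<partial>lborel) = (\<integral>\<^sup>+y. liminf (\<lambda>n. e (u n) x y) \<partial>lborel)"
      using lim AE_lborel_singleton[of x]
      by (intro nn_integral_cong_AE, eventually_elim) (use pt x in auto)
    also have "\<dots> \<le> liminf (\<lambda>n. \<integral>\<^sup>+y. e (u n) x y \<partial>lborel)"
      by (rule nn_integral_liminf) measurable
    finally show "(\<integral>\<^sup>+y. e w x y \<partial>lborel) \<le> liminf (\<lambda>n. \<integral>\<^sup>+y. e (u n) x y \<partial>lborel)" .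
  qed
  also have "\<dots> \<le> liminf (\<lambda>n. \<integral>\<^sup>+x. (\<integral>\<^sup>+y. e (u n) x y \<partial>lborel) \<partial>lborel)"
    by (rule nn_integral_liminf) measurable
  also have "\<dots> = liminf (\<lambda>n. interaction K p (u n))" by (simp add: interaction_def e_def)
  also have "\<dots> \<le> liminf (\<lambda>n. B)" by (intro Liminf_mono) (simp add: le)
  also have "\<dots> = B" by (simp add: Liminf_const)
  finally show ?thesis .
qed

context
  fixes c :: "'a::euclidean_space" and R :: real and f :: "'a \<Rightarrow> real"
  assumes R: "R > 0" and f_meas [measurable]: "f \<in> borel_measurable borel" and f0: "\<And>x. 0 \<le> f x"
    and fR: "\<And>x. R \<le> dist c x \<Longrightarrow> f x = 0"
begin

lemma unit_profile_squash: "unit_profile c R (\<lambda>x. squash (f x))"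
  unfolding unit_profile_def using squash_bounds[OF f0] by (auto simp: fR) (simp add: squash_def)

lemma symmetrize_measurable [measurable]: "symmetrize c f \<in> borel_measurable borel"
proof -
  note [measurable] = rearrange_measurable[OF unit_profile_squash]
  show ?thesis unfolding symmetrize_def by measurable
qed

lemma symmetrize_nonneg: "0 \<le> symmetrize c f x"
  unfolding symmetrize_def
  by (intro unsquash_nonneg rearrange_nonneg[OF unit_profile_squash] rearrange_le_1[OF unit_profile_squash])

lemma symmetrize_eq_0:
  assumes "measure lborel {x. f x > 0} \<le> measure lborel (ball c r)" "0 \<le> r" "r \<le> dist c x"
  shows "symmetrize c f x = 0"
proof -
  have "{x. squash (f x) > 0} = {x. f x > 0}"
    using f0 by (auto simp: squash_def zero_less_divide_iff add_pos_nonneg) (smt (verit) f0)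
  then have "rearrange c (\<lambda>x. squash (f x)) x = 0"
    using assms by (intro rearrange_eq_0[OF unit_profile_squash]) (auto simp: superlevel_measure_def)
  then show ?thesis by (simp add: symmetrize_def unsquash_def)
qed

lemma nn_integral_symmetrize_powr:
  assumes p: "p > 0"
  shows "(\<integral>\<^sup>+x. ennreal (symmetrize c f x powr p) \<partial>lborel) = (\<integral>\<^sup>+x. ennreal (f x powr p) \<partial>lborel)"
proof -
  let ?g = "\<lambda>x. squash (f x)"
  note g = unit_profile_squash
  note [measurable] = rearrange_measurable[OF g]
  have "(\<integral>\<^sup>+x. ennreal (symmetrize c f x powr p) \<partial>lborel) =
    (\<integral>\<^sup>+t. indicator {0..} t * emeasure lborel {x. squash (t powr (1 / p)) < rearrange c ?g x} \<partial>lborel)"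
    unfolding symmetrize_def
  proof (rule nn_integral_unsquash_powr[OF p])
    show "AE x in lborel. rearrange c ?g x < 1"
      using AE_lborel_singleton[of c] by eventually_elim (rule rearrange_less_1[OF g])
  qed (auto simp: rearrange_nonneg[OF g] rearrange_le_1[OF g])
  also have "\<dots> = (\<integral>\<^sup>+t. indicator {0..} t * emeasure lborel {x. squash (t powr (1 / p)) < ?g x} \<partial>lborel)"
    using emeasure_rearrange_superlevel[OF g] squash_bounds by simp
  also have "\<dots> = (\<integral>\<^sup>+x. ennreal (unsquash (?g x) powr p) \<partial>lborel)"
    using squash_bounds[OF f0] by (intro nn_integral_unsquash_powr[OF p, symmetric]) (auto intro: less_imp_le)
  also have "\<dots> = (\<integral>\<^sup>+x. ennreal (f x powr p) \<partial>lborel)" by (simp add: unsquash_squash f0)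
  finally show ?thesis .
qed

text \<open>
  Every polarization of \<open>f / (1 + f)\<close> corresponds to one of \<open>f\<close> and does not raise the interaction;
  the symmetrization is an almost everywhere limit of such functions.
\<close>
lemma interaction_symmetrize_le:
  assumes p: "p \<ge> 1" and K: "K \<in> borel_measurable borel" and anti: "\<And>s t. 0 \<le> s \<Longrightarrow> s \<le> t \<Longrightarrow> K t \<le> K s"
    and fin: "\<And>t. t > 0 \<Longrightarrow> K t < top"
  shows "interaction K p (symmetrize c f) \<le> interaction K p f"
proof -
  let ?g = "\<lambda>x. squash (f x)"
  note g = unit_profile_squash
  have pol: "interaction K p (\<lambda>x. unsquash (h x)) \<le> interaction K p f" if "h \<in> polarizations c ?g" for h
    using that
  proof induction
    case base
    show ?case by (simp add: unsquash_squash f0)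
  next
    case (step h v)
    note hp = polarizations_profile(1)[OF step(1) g]
    note [measurable] = profile_measurable[OF hp]
    have eq: "(\<lambda>x. unsquash (polarize c v h x)) = polarize c v (\<lambda>x. unsquash (h x))"
      using profile_bounds[OF hp] unsquash_mono
      by (intro ext polarize_mono_comp[symmetric, where S = "{0..<1}"]) auto
    have "interaction K p (\<lambda>x. unsquash (polarize c v h x)) \<le> interaction K p (\<lambda>x. unsquash (h x))"
      unfolding eq by (rule interaction_polarize_le[OF p _ K anti]) measurable
    also note step(2)
    finally show ?case .
  qed
  obtain h where h: "\<And>n. h n \<in> polarizations c ?g"
    and lim: "AE x in lborel. (\<lambda>n. h n x) \<longlonglongrightarrow> rearrange c ?g x"
    using polarizations_converge_AE[OF g R] by blast
  note [measurable] = profile_measurable[OF polarizations_profile(1)[OF h g]]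
  show ?thesis
  proof (rule interaction_le_of_AE_limit[where u = "\<lambda>n x. unsquash (h n x)"])
    show "AE x in lborel. (\<lambda>n. unsquash (h n x)) \<longlonglongrightarrow> symmetrize c f x"
      using lim AE_lborel_singleton[of c]
    proof eventually_elim
      case (elim x)
      then have "rearrange c ?g x < 1" by (intro rearrange_less_1[OF g])
      then show ?case unfolding symmetrize_def unsquash_def using elim(1) by (intro tendsto_intros) auto
    qed
  qed (use p K fin pol[OF h] in auto)
qed

end

section \<open>The energy as an interaction\<close>

text \<open>
  In \<^typ>\<open>ennreal\<close> the inverse of \<open>0\<close> is infinite, so this kernel is monotone on \<open>{0..}\<close>, unlike the real
  quotient \<open>1 / t ^ N\<close>.
\<close>
definition log_kernel :: "nat \<Rightarrow> real \<Rightarrow> real \<Rightarrow> ennreal" where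
  "log_kernel N D t = (if t < D then inverse (ennreal (t ^ N)) else 0)"

lemma measurable_log_kernel [measurable]: "log_kernel N D \<in> borel_measurable borel"
  unfolding log_kernel_def by measurable

lemma log_kernel_antimono:
  assumes "0 \<le> s" "s \<le> t"
  shows "log_kernel N D t \<le> log_kernel N D s"
proof -
  have "inverse (ennreal (t ^ N)) \<le> inverse (ennreal (s ^ N))"
  proof (cases "s ^ N = 0")
    case True
    then have "inverse (ennreal (s ^ N)) = top" by (simp only: ennreal_0 ennreal_inverse_zero)
    then show ?thesis by simp
  next
    case False
    have "0 \<le> s ^ N" using assms by simp
    then have pos: "0 < s ^ N" using False by linarith
    have le: "s ^ N \<le> t ^ N" using assms by (intro power_mono)
    have "inverse (t ^ N) \<le> inverse (s ^ N)" using pos le by (rule le_imp_inverse_le[rotated])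
    then show ?thesis using pos le by (simp only: inverse_ennreal order.strict_trans2[OF pos le] ennreal_leI)
  qed
  then show ?thesis using assms(2) by (auto simp: log_kernel_def)
qed

lemma log_kernel_finite: "0 < t \<Longrightarrow> log_kernel N D t < top"
  by (auto simp: log_kernel_def inverse_ennreal)

lemma log_kernel_integrand:
  fixes u :: "'a::euclidean_space \<Rightarrow> real"
  shows "ennreal (\<bar>u x - u y\<bar> powr p) * log_kernel DIM('a) D (dist x y) =
    ennreal (indicator {z. norm (fst z - snd z) < D} (x, y) * (\<bar>u x - u y\<bar> powr p / norm (x - y) ^ DIM('a)))"
proof (cases "x = y")
  case False
  then have "ennreal (\<bar>u x - u y\<bar> powr p) * inverse (ennreal (norm (x - y) ^ DIM('a))) =
      ennreal (\<bar>u x - u y\<bar> powr p / norm (x - y) ^ DIM('a))"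
    by (subst divide_ennreal[symmetric]) (auto simp: divide_ennreal_def)
  then show ?thesis by (auto simp: log_kernel_def dist_norm indicator_def)
qed simp

lemma AE_pair_both:
  assumes [measurable]: "Measurable.pred borel Q" and Q: "AE x in (lborel :: 'a::euclidean_space measure). Q x"
  shows "AE z in (lborel :: 'a measure) \<Otimes>\<^sub>M (lborel :: 'a measure). Q (fst z) \<and> Q (snd z)"
proof (rule lborel_pair.AE_pair_measure)
  show "{z \<in> space (lborel \<Otimes>\<^sub>M lborel). Q (fst z) \<and> Q (snd z)} \<in> sets (lborel \<Otimes>\<^sub>M lborel)"
    by measurable
  show "AE x in lborel. AE y in lborel. Q (fst (x, y)) \<and> Q (snd (x, y))"
    using Q
  proof eventually_elim
    case (elim x)
    show ?case using Q by eventually_elim (use elim in auto)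
  qed
qed

text \<open>
  The part of the kernel at distances from \<open>1\<close> to \<open>D\<close>, where the near and the localized far term of
  the energy overlap. It is integrable, which makes it possible to integrate the three terms of
  the far integrand separately.
\<close>
definition shell_weight :: "real \<Rightarrow> 'a::euclidean_space \<Rightarrow> real" where
  "shell_weight D z = indicator {z. 1 \<le> norm z \<and> norm z < D} z / norm z ^ DIM('a)"

lemma measurable_shell_weight [measurable]: "shell_weight D \<in> borel_measurable borel"
  unfolding shell_weight_def by measurable

lemma shell_weight_nonneg: "0 \<le> shell_weight D z"
  by (simp add: shell_weight_def)

lemma shell_weight_integrable: "integrable lborel (shell_weight D :: 'a::euclidean_space \<Rightarrow> real)"
proof (rule Bochner_Integration.integrable_bound)
  show "integrable lborel (indicator (ball (0::'a) D) :: 'a \<Rightarrow> real)"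
    using emeasure_lborel_ball_finite[of "0::'a" D] by (intro integrable_real_indicator) auto
  show "AE x in lborel. norm (shell_weight D x) \<le> norm (indicator (ball (0::'a) D) x :: real)"
  proof (intro AE_I2)
    fix x :: 'a
    have "1 / norm x ^ DIM('a) \<le> 1" if "1 \<le> norm x" using one_le_power[OF that, of "DIM('a)"] by simp
    then show "norm (shell_weight D x) \<le> norm (indicator (ball (0::'a) D) x :: real)"
      by (auto simp: shell_weight_def indicator_def)
  qed
qed measurable

lemma nn_integral_diff_even:
  fixes h :: "'a::euclidean_space \<Rightarrow> ennreal"
  assumes [measurable]: "h \<in> borel_measurable borel" and even: "\<And>z. h (- z) = h z"
  shows "(\<integral>\<^sup>+y. h (x - y) \<partial>lborel) = (\<integral>\<^sup>+y. h y \<partial>lborel)"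
proof -
  have "(\<integral>\<^sup>+y. h y \<partial>lborel) = (\<integral>\<^sup>+y. h y \<partial>distr lborel borel ((+) (- x)))"
    by (simp only: lborel_distr_plus)
  also have "\<dots> = (\<integral>\<^sup>+y. h (- x + y) \<partial>lborel)" by (rule nn_integral_distr) auto
  also have "\<dots> = (\<integral>\<^sup>+y. h (x - y) \<partial>lborel)"
    by (intro nn_integral_cong) (use even[of "x - _"] in simp)
  finally show ?thesis ..
qed

text \<open>
  If \<open>\<bar>x - y\<bar> \<ge> D\<close>, then \<open>x\<close> or \<open>y\<close> is outside the ball and the far integrand vanishes. For
  \<open>1 \<le> \<bar>x - y\<bar> < D\<close> the first of its three terms extends the near integral to all distances below
  \<open>D\<close>, and each of the other two contributes the integral of the shell weight times the norm.
\<close>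
lemma energy_localized:
  fixes u :: "'a::euclidean_space \<Rightarrow> real" and p D :: real
  assumes p: "p > 0" and D: "D \<ge> 1"
    and um[measurable]: "u \<in> borel_measurable borel" and ui: "integrable lborel (\<lambda>x. \<bar>u x\<bar> powr p)"
    and supp: "AE x in lborel. x \<notin> ball c (D / 2) \<longrightarrow> u x = 0"
    and fin: "interaction (log_kernel DIM('a) 1) p u < top"
  shows "interaction (log_kernel DIM('a) D) p u < top"
    and "energy p u = C_const DIM('a) p / 2 * enn2real (interaction (log_kernel DIM('a) D) p u)
      + (rho_const DIM('a) p - C_const DIM('a) p * integral\<^sup>L lborel (shell_weight D :: 'a \<Rightarrow> real)) * (LINT x|lborel. \<bar>u x\<bar> powr p)"
proof -
  let ?N = "DIM('a)" and ?M = "(lborel :: 'a measure) \<Otimes>\<^sub>M (lborel :: 'a measure)"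
  define A where "A z = \<bar>u (fst z) - u (snd z)\<bar> powr p / norm (fst z - snd z) ^ ?N" for z
  define A1 where "A1 z = indicator {z. norm (fst z - snd z) < 1} z * A z" for z
  define AD where "AD z = indicator {z. norm (fst z - snd z) < D} z * A z" for z
  define A2 where "A2 z = AD z - A1 z" for z
  define w where "w z = shell_weight D (fst z - snd z)" for z :: "'a \<times> 'a"
  define B where "B z = \<bar>u (fst z)\<bar> powr p * w z" for z
  define B' where "B' z = \<bar>u (snd z)\<bar> powr p * w z" for z
  define \<kappa> where "\<kappa> = integral\<^sup>L lborel (shell_weight D :: 'a \<Rightarrow> real)"
  define P where "P = (LINT x|lborel. \<bar>u x\<bar> powr p)"
  have \<kappa>0: "0 \<le> \<kappa>" unfolding \<kappa>_def by (intro Bochner_Integration.integral_nonneg shell_weight_nonneg)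
  have P0: "0 \<le> P" unfolding P_def by (intro Bochner_Integration.integral_nonneg) auto
  have [measurable]: "A \<in> borel_measurable ?M" "A1 \<in> borel_measurable ?M" "AD \<in> borel_measurable ?M"
    "A2 \<in> borel_measurable ?M" "w \<in> borel_measurable ?M" "B \<in> borel_measurable ?M" "B' \<in> borel_measurable ?M"
    unfolding A_def A1_def AD_def A2_def B_def B'_def w_def by measurable
  have A0: "0 \<le> A z" and A10: "0 \<le> A1 z" and AD0: "0 \<le> AD z" for z
    by (simp_all add: A_def A1_def AD_def)
  have inter: "interaction (log_kernel ?N E) p u = (\<integral>\<^sup>+z. ennreal (indicator {z. norm (fst z - snd z) < E} z * A z) \<partial>?M)" for E
    unfolding interaction_def log_kernel_integrand A_def by (subst lborel.nn_integral_fst[symmetric]) auto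
  have I1: "integrable ?M A1"
    using fin A10 unfolding inter by (intro integrableI_nonneg) (auto simp: A1_def)
  have shell: "(\<integral>\<^sup>+y. ennreal (shell_weight D (x - y)) \<partial>lborel) = ennreal \<kappa>" for x :: 'a
  proof -
    have "(\<integral>\<^sup>+y. ennreal (shell_weight D (x - y)) \<partial>lborel) = (\<integral>\<^sup>+y. ennreal (shell_weight D (y::'a)) \<partial>lborel)"
      by (rule nn_integral_diff_even) (auto simp: shell_weight_def indicator_def)
    also have "\<dots> = ennreal \<kappa>"
      unfolding \<kappa>_def by (intro nn_integral_eq_integral shell_weight_integrable) (simp add: shell_weight_nonneg)
    finally show ?thesis .
  qed
  have Pnn: "(\<integral>\<^sup>+x. ennreal (\<bar>u x\<bar> powr p) \<partial>lborel) = ennreal P"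
    unfolding P_def using ui by (intro nn_integral_eq_integral) auto
  have Bnn: "(\<integral>\<^sup>+z. ennreal (B z) \<partial>?M) = ennreal (\<kappa> * P)"
  proof -
    have "(\<integral>\<^sup>+z. ennreal (B z) \<partial>?M) = (\<integral>\<^sup>+x. (\<integral>\<^sup>+y. ennreal (\<bar>u x\<bar> powr p) * ennreal (shell_weight D (x - y)) \<partial>lborel) \<partial>lborel)"
      by (subst lborel.nn_integral_fst[symmetric]) (auto simp: B_def w_def ennreal_mult shell_weight_nonneg)
    also have "\<dots> = (\<integral>\<^sup>+x. ennreal (\<bar>u x\<bar> powr p) * ennreal \<kappa> \<partial>lborel)"
      by (simp add: nn_integral_cmult shell)
    also have "\<dots> = (\<integral>\<^sup>+x. ennreal (\<bar>u x\<bar> powr p) \<partial>lborel) * ennreal \<kappa>"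
      by (rule nn_integral_multc) measurable
    also have "\<dots> = ennreal (\<kappa> * P)"
      by (simp add: Pnn ennreal_mult \<kappa>0 P0 mult.commute)
    finally show ?thesis .
  qed
  have B'nn: "(\<integral>\<^sup>+z. ennreal (B' z) \<partial>?M) = ennreal (\<kappa> * P)"
  proof -
    have "(\<integral>\<^sup>+z. ennreal (B' z) \<partial>?M) = (\<integral>\<^sup>+x. (\<integral>\<^sup>+y. ennreal (B' (x, y)) \<partial>lborel) \<partial>lborel)"
      by (rule lborel.nn_integral_fst[symmetric]) measurable
    also have "\<dots> = (\<integral>\<^sup>+y. (\<integral>\<^sup>+x. ennreal (B' (x, y)) \<partial>lborel) \<partial>lborel)"
      by (rule lborel_pair.Fubini'[symmetric]) measurable
    also have "\<dots> = (\<integral>\<^sup>+y. (\<integral>\<^sup>+x. ennreal (B (y, x)) \<partial>lborel) \<partial>lborel)"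
      by (intro nn_integral_cong) (auto simp: B_def B'_def w_def shell_weight_def norm_minus_commute indicator_def)
    also have "\<dots> = (\<integral>\<^sup>+z. ennreal (B z) \<partial>?M)"
      by (rule lborel.nn_integral_fst) measurable
    finally show ?thesis by (simp add: Bnn)
  qed
  have B0: "0 \<le> B z" "0 \<le> B' z" for z by (simp_all add: B_def B'_def w_def shell_weight_nonneg)
  have IB: "integrable ?M B" "integrable ?M B'"
    using Bnn B'nn B0 by (auto intro!: integrableI_nonneg)
  have LB: "(LINT z|?M. B z) = \<kappa> * P" "(LINT z|?M. B' z) = \<kappa> * P"
    using integral_eq_nn_integral[of B ?M] integral_eq_nn_integral[of B' ?M] Bnn B'nn B0 \<kappa>0 P0 by auto
  have A2w: "A2 z = \<bar>u (fst z) - u (snd z)\<bar> powr p * w z" for z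
    using D by (auto simp: A2_def AD_def A1_def A_def w_def shell_weight_def indicator_def)
  \<comment> \<open>Integrability of the overlap: the difference is dominated by the two separate terms.\<close>
  have split: "\<bar>s - t\<bar> powr p \<le> 2 powr p * (\<bar>s\<bar> powr p + \<bar>t\<bar> powr p)" for s t :: real
  proof -
    have "\<bar>s - t\<bar> powr p \<le> (2 * max \<bar>s\<bar> \<bar>t\<bar>) powr p" using p by (intro powr_mono2) auto
    also have "\<dots> = 2 powr p * (max \<bar>s\<bar> \<bar>t\<bar>) powr p" by (simp add: powr_mult)
    also have "\<dots> \<le> 2 powr p * (\<bar>s\<bar> powr p + \<bar>t\<bar> powr p)"
      by (intro mult_left_mono) (auto simp: max_def)
    finally show ?thesis .
  qed
  have "\<bar>A2 z\<bar> \<le> 2 powr p * (B z + B' z)" for z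
  proof -
    have w0: "0 \<le> w z" by (simp add: w_def shell_weight_nonneg)
    then have "\<bar>A2 z\<bar> = \<bar>u (fst z) - u (snd z)\<bar> powr p * w z" by (simp add: A2w abs_mult)
    also have "\<dots> \<le> 2 powr p * (\<bar>u (fst z)\<bar> powr p + \<bar>u (snd z)\<bar> powr p) * w z"
      by (intro mult_right_mono split w0)
    also have "\<dots> = 2 powr p * (B z + B' z)" unfolding B_def B'_def by (simp add: algebra_simps)
    finally show ?thesis .
  qed
  then have I2: "integrable ?M A2"
    by (intro Bochner_Integration.integrable_bound[OF integrable_mult_right[OF Bochner_Integration.integrable_add[OF IB], of "2 powr p"]])
      (auto simp: B0)
  have "AD = (\<lambda>z. A1 z + A2 z)" by (auto simp: A2_def)
  then have ID: "integrable ?M AD" and LD: "(LINT z|?M. AD z) = (LINT z|?M. A1 z) + (LINT z|?M. A2 z)"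
    using I1 I2 by auto
  have iD: "interaction (log_kernel ?N D) p u = ennreal (LINT z|?M. AD z)"
    unfolding inter AD_def[symmetric] using ID AD0 by (intro nn_integral_eq_integral) auto
  show "interaction (log_kernel ?N D) p u < top" unfolding iD by simp
  have first: "(LINT z:{(x, y). norm (x - y) < 1}|?M. (case z of (x, y) \<Rightarrow> \<bar>u x - u y\<bar> powr p / norm (x - y) ^ ?N)) = (LINT z|?M. A1 z)"
    unfolding set_lebesgue_integral_def A1_def A_def by (simp add: split_beta')
  have far: "AE z in ?M. (fst z \<notin> ball c (D / 2) \<longrightarrow> u (fst z) = 0) \<and> (snd z \<notin> ball c (D / 2) \<longrightarrow> u (snd z) = 0)"
    by (rule AE_pair_both[OF _ supp]) (simp only: mem_ball, measurable)
  have third: "(LINT z:{(x, y). norm (x - y) \<ge> 1}|?M. (case z of (x, y) \<Rightarrow> (\<bar>u x - u y\<bar> powr p - \<bar>u x\<bar> powr p - \<bar>u y\<bar> powr p) / norm (x - y) ^ ?N))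
     = (LINT z|?M. A2 z - B z - B' z)"
    unfolding set_lebesgue_integral_def
  proof (rule integral_cong_AE)
    show "AE z in ?M. indicat_real {(x, y). norm (x - y) \<ge> 1} z *\<^sub>R (case z of (x, y) \<Rightarrow> (\<bar>u x - u y\<bar> powr p - \<bar>u x\<bar> powr p - \<bar>u y\<bar> powr p) / norm (x - y) ^ ?N)
      = A2 z - B z - B' z"
      using far
    proof eventually_elim
      case (elim z)
      obtain x y where z: "z = (x, y)" by (cases z)
      show ?case
      proof (cases "norm (x - y) < D")
        case True
        then show ?thesis unfolding A2w B_def B'_def w_def shell_weight_def z
          by (auto simp: indicator_def diff_divide_distrib)
      next
        case False
        have "dist x y \<le> dist c x + dist c y" by (rule dist_triangle3)
        then have "u x = 0 \<or> u y = 0" using elim False unfolding z by (auto simp: dist_norm)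
        then show ?thesis using False unfolding A2w B_def B'_def w_def shell_weight_def z
          by (auto simp: indicator_def)
      qed
    qed
  qed (measurable)
  have parts: "(LINT z|?M. A2 z - B z - B' z) = (LINT z|?M. A2 z) - \<kappa> * P - \<kappa> * P"
    using I2 IB by (simp add: LB)
  show "energy p u = C_const ?N p / 2 * enn2real (interaction (log_kernel ?N D) p u)
      + (rho_const ?N p - C_const ?N p * integral\<^sup>L lborel (shell_weight D :: 'a \<Rightarrow> real)) * (LINT x|lborel. \<bar>u x\<bar> powr p)"
    unfolding energy_def first third parts iD LD \<kappa>_def[symmetric] P_def[symmetric]
    using Bochner_Integration.integral_nonneg[where M = ?M and f = A1] A10 LD Bochner_Integration.integral_nonneg[where M = ?M and f = AD] AD0
    by (simp add: algebra_simps)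
qed

section \<open>Comparison of the eigenvalues\<close>

lemma interaction_mono_AE:
  assumes p: "p \<ge> 0" and le: "AE x in lborel. AE y in lborel. \<bar>v x - v y\<bar> \<le> \<bar>u x - u y\<bar>"
  shows "interaction K p v \<le> interaction K p u"
  unfolding interaction_def
proof (rule nn_integral_mono_AE, use le in eventually_elim)
  fix x assume x: "AE y in lborel. \<bar>v x - v y\<bar> \<le> \<bar>u x - u y\<bar>"
  show "(\<integral>\<^sup>+y. ennreal (\<bar>v x - v y\<bar> powr p) * K (dist x y) \<partial>lborel)
      \<le> (\<integral>\<^sup>+y. ennreal (\<bar>u x - u y\<bar> powr p) * K (dist x y) \<partial>lborel)"
    by (rule nn_integral_mono_AE, use x in eventually_elim)
      (use p in \<open>auto intro!: mult_right_mono ennreal_leI powr_mono2\<close>)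
qed

lemma X0_seminorm_eq_interaction:
  fixes u :: "'a::euclidean_space \<Rightarrow> real"
  shows "(\<integral>\<^sup>+ x. (\<integral>\<^sup>+ y \<in> ball x 1. ennreal (\<bar>u x - u y\<bar> powr p / norm (x - y) ^ DIM('a)) \<partial>lborel) \<partial>lborel)
    = interaction (log_kernel DIM('a) 1) p u"
  unfolding interaction_def log_kernel_integrand
  by (intro nn_integral_cong) (auto simp: indicator_def dist_norm)

lemma set_integral_powr_eq:
  fixes u :: "'a::euclidean_space \<Rightarrow> real"
  assumes [measurable]: "u \<in> borel_measurable borel" "U \<in> sets borel"
    and "AE x in lborel. x \<notin> U \<longrightarrow> u x = 0"
  shows "(LINT x:U|lborel. \<bar>u x\<bar> powr p) = enn2real (\<integral>\<^sup>+x. ennreal (\<bar>u x\<bar> powr p) \<partial>lborel)"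
proof -
  have "(LINT x:U|lborel. \<bar>u x\<bar> powr p) = (LINT x|lborel. \<bar>u x\<bar> powr p)"
    unfolding set_lebesgue_integral_def
  proof (rule integral_cong_AE)
    show "AE x in lborel. indicat_real U x *\<^sub>R \<bar>u x\<bar> powr p = \<bar>u x\<bar> powr p"
      using assms(3) by eventually_elim (auto simp: indicator_def)
  qed measurable
  also have "\<dots> = enn2real (\<integral>\<^sup>+x. ennreal (\<bar>u x\<bar> powr p) \<partial>lborel)"
    by (rule integral_eq_nn_integral) auto
  finally show ?thesis .
qed

text \<open>
  The competitor is the symmetrization of \<open>\<bar>u\<bar>\<close>. Passing from \<open>u\<close> to \<open>\<bar>u\<bar>\<close> does not raise the interaction because
  \<open>\<bar>\<bar>s\<bar> - \<bar>t\<bar>\<bar> \<le> \<bar>s - t\<bar>\<close>, and redefining \<open>\<bar>u\<bar>\<close> to be \<open>0\<close> everywhere off \<open>\<Omega>\<close> changes nothing almost everywhere.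
  Both functions live in a common ball of radius \<open>R\<close>, so one value \<open>D = 2 R\<close> serves for both
  energies, and the multiples of the norm in the localized formula agree.
\<close>
lemma symmetrize_competitor:
  fixes \<Omega> :: "'a::euclidean_space set" and c :: 'a and r p :: real
  assumes \<Omega>: "open \<Omega>" "bounded \<Omega>" and r: "r > 0" and vol: "emeasure lborel \<Omega> \<le> emeasure lborel (ball c r)"
    and p: "p > 1" and u: "u \<in> X0 p \<Omega>" and norm: "Lp_norm p \<Omega> u = 1"
  shows "\<exists>v \<in> X0 p (ball c r). Lp_norm p (ball c r) v = 1 \<and> energy p v \<le> energy p u"
proof -
  have um[measurable]: "u \<in> borel_measurable borel" and ui: "integrable lborel (\<lambda>x. \<bar>u x\<bar> powr p)"
    and u0: "AE x in lborel. x \<notin> \<Omega> \<longrightarrow> u x = 0"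
    and ufin: "interaction (log_kernel DIM('a) 1) p u < top"
    using u by (auto simp: X0_def X0_seminorm_eq_interaction)
  have [measurable]: "\<Omega> \<in> sets borel" using \<Omega>(1) by simp
  obtain R0 where R0: "\<Omega> \<subseteq> ball c R0" using \<Omega>(2) bounded_subset_ballD by blast
  define R where "R = max 1 (max R0 r)"
  have R: "R \<ge> 1" "r \<le> R" "\<Omega> \<subseteq> ball c R" using R0 by (auto simp: R_def)
  define f where "f x = indicator \<Omega> x * \<bar>u x\<bar>" for x
  have [measurable]: "f \<in> borel_measurable borel" unfolding f_def by measurable
  have f0: "0 \<le> f x" for x by (simp add: f_def)
  have fR: "f x = 0" if "R \<le> dist c x" for x using that R(3) by (auto simp: f_def indicator_def)
  have fu: "AE x in lborel. f x = \<bar>u x\<bar>"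
    using u0 by eventually_elim (auto simp: f_def indicator_def)
  have Rpos: "R > 0" using R by simp
  note ctx = Rpos \<open>f \<in> borel_measurable borel\<close> f0 fR
  define v where "v = symmetrize c f"
  have vm[measurable]: "v \<in> borel_measurable borel"
    unfolding v_def by (rule symmetrize_measurable[OF ctx])
  have v0: "0 \<le> v x" for x unfolding v_def by (rule symmetrize_nonneg[OF ctx])
  have "{x. f x > 0} \<subseteq> \<Omega>" by (auto simp: f_def indicator_def split: if_splits)
  then have "emeasure lborel {x. f x > 0} \<le> emeasure lborel (ball c r)"
    using vol emeasure_mono[of "{x. f x > 0}" \<Omega> lborel] by (auto intro: order_trans)
  then have "measure lborel {x. f x > 0} \<le> measure lborel (ball c r)"
    unfolding measure_def using emeasure_lborel_ball_finite[of c r] by (intro enn2real_mono) auto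
  then have vr: "v x = 0" if "r \<le> dist c x" for x
    unfolding v_def using that r by (intro symmetrize_eq_0[OF ctx, where r = r]) auto
  have vnn: "(\<integral>\<^sup>+x. ennreal (\<bar>v x\<bar> powr p) \<partial>lborel) = (\<integral>\<^sup>+x. ennreal (\<bar>u x\<bar> powr p) \<partial>lborel)"
  proof -
    have "(\<integral>\<^sup>+x. ennreal (\<bar>v x\<bar> powr p) \<partial>lborel) = (\<integral>\<^sup>+x. ennreal (f x powr p) \<partial>lborel)"
      using nn_integral_symmetrize_powr[OF ctx, where p = p] p v0 by (simp add: v_def)
    also have "\<dots> = (\<integral>\<^sup>+x. ennreal (\<bar>u x\<bar> powr p) \<partial>lborel)"
      using fu by (intro nn_integral_cong_AE, eventually_elim) auto
    finally show ?thesis .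
  qed
  have vi: "integrable lborel (\<lambda>x. \<bar>v x\<bar> powr p)"
    using ui vnn by (intro integrableI_nonneg) (auto simp: integrable_iff_bounded)
  have vsupp: "AE x in lborel. x \<notin> ball c r \<longrightarrow> v x = 0" using vr by (intro AE_I2) auto
  have inter: "interaction (log_kernel DIM('a) D) p v \<le> interaction (log_kernel DIM('a) D) p u" for D
  proof -
    have "interaction (log_kernel DIM('a) D) p v \<le> interaction (log_kernel DIM('a) D) p f"
      unfolding v_def using p
      by (intro interaction_symmetrize_le[OF ctx]) (auto intro: log_kernel_antimono log_kernel_finite)
    also have "\<dots> \<le> interaction (log_kernel DIM('a) D) p u"
    proof (rule interaction_mono_AE)
      show "AE x in lborel. AE y in lborel. \<bar>f x - f y\<bar> \<le> \<bar>u x - u y\<bar>"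
        using fu
      proof eventually_elim
        case (elim x)
        show ?case using fu by eventually_elim (use elim in auto)
      qed
    qed (use p in simp)
    finally show ?thesis .
  qed
  have vfin: "interaction (log_kernel DIM('a) 1) p v < top"
    using inter[of 1] ufin by (rule le_less_trans)
  have "v \<in> X0 p (ball c r)"
    using vi vsupp vfin by (simp add: X0_def X0_seminorm_eq_interaction)
  moreover have "Lp_norm p (ball c r) v = 1"
    using norm vnn vsupp u0 by (simp add: Lp_norm_def set_integral_powr_eq)
  moreover have "energy p v \<le> energy p u"
  proof -
    have usupp: "AE x in lborel. x \<notin> ball c (2 * R / 2) \<longrightarrow> u x = 0"
      using u0 R(3) by (auto elim!: eventually_mono)
    have vsupp': "AE x in lborel. x \<notin> ball c (2 * R / 2) \<longrightarrow> v x = 0"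
      using vr R(2) by (intro AE_I2) auto
    have D: "2 * R \<ge> 1" and p0: "p > 0" using R p by auto
    have LP: "(LINT x|lborel. \<bar>v x\<bar> powr p) = (LINT x|lborel. \<bar>u x\<bar> powr p)"
      by (subst (1 2) integral_eq_nn_integral) (auto simp: vnn)
    have C: "C_const DIM('a) p \<ge> 0"
      using p by (auto simp: C_const_def intro!: divide_nonneg_nonneg mult_nonneg_nonneg less_imp_le[OF Gamma_real_pos])
    have "enn2real (interaction (log_kernel DIM('a) (2 * R)) p v) \<le> enn2real (interaction (log_kernel DIM('a) (2 * R)) p u)"
      using inter energy_localized(1)[OF p0 D um ui usupp ufin] by (intro enn2real_mono) auto
    then show ?thesis
      unfolding energy_localized(2)[OF p0 D um ui usupp ufin] energy_localized(2)[OF p0 D vm vi vsupp' vfin] LP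
      using C by (intro add_right_mono mult_left_mono) auto
  qed
  ultimately show ?thesis by blast
qed

theorem corollary1p4:
  fixes \<Omega> :: "'a::euclidean_space set" and c :: 'a and r m p :: real
  assumes "open \<Omega>" and "bounded \<Omega>" and "lipschitz_boundary \<Omega>"
    and "m > 0" and "emeasure lborel \<Omega> = ennreal m"
    and "p > 1"
    and "emeasure lborel (ball c r) = ennreal m"
  shows "lambda1 p (ball c r) \<le> lambda1 p \<Omega>"
  unfolding lambda1_def
proof (rule INF_greatest)
  fix u assume u: "u \<in> {u \<in> X0 p \<Omega>. Lp_norm p \<Omega> u = 1}"
  have "r > 0"
  proof (rule ccontr)
    assume "\<not> r > 0"
    then have "emeasure lborel (ball c r) = 0" by (simp add: ball_empty)
    then show False using assms(4,7) by simp
  qed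
  then obtain v where "v \<in> X0 p (ball c r)" "Lp_norm p (ball c r) v = 1" "energy p v \<le> energy p u"
    using symmetrize_competitor[of \<Omega> r c p u] assms u by auto
  then show "(INF u\<in>{u \<in> X0 p (ball c r). Lp_norm p (ball c r) u = 1}. ereal (energy p u)) \<le> ereal (energy p u)"
    by (intro INF_lower2[of v]) auto
qed

end
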